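(* Let $\mathcal{H}$ be an infinite-dimensional, separable, complex Hilbert space, and suppose that $U$ and $V$ are unitary operators on $\mathcal{H}$ such that the minimal polynomial of $U$ is a quadratic polynomial (degree $2$) and the minimal polynomial of $V$ is a cubic polynomial (degree $3$). Then there exist $U_0 \in \mathcal{U}(U)$ and $V_0 \in \mathcal{U}(V)$ such that the algebra generated by $U_0$ and $V_0$, closed in the weak-operator topology, is all of $\mathcal{B}(\mathcal{H})$ if and only if both of the following hold: (a) both of the eigenspaces of $U$ are infinite-dimensional, and (b) at least two of the eigenspaces of $V$ are infinite-dimensional.
   Context: $\mathcal{B}(\mathcal{H})$ is the algebra of all bounded linear operators on $\mathcal{H}$. For $T \in \mathcal{B}(\mathcal{H})$, the unitary orbit of $T$ is $\mathcal{U}(T) := \{W^* T W : W \in \mathcal{B}(\mathcal{H}) \text{ unitary}\}$. The weak-operator closed algebra generated by $U_0$ and $V_0$ is the closure in the weak-operator topology of the algebra generated by $U_0$ and $V_0$. *)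

theory Defs
  imports "HOL-Analysis.Analysis" "HOL-Computational_Algebra.Polynomial"
begin

section \<open>Complex Hilbert spaces\<close>

text \<open>The distribution has only real inner product spaces. The inner product below is linear in
  the first and conjugate-linear in the second argument. That the norm satisfies the axioms of
  \<^class>\<open>real_normed_vector\<close> would follow from the other axioms; assuming it makes the library
  theory of normed spaces available and excludes no model.\<close>

class complex_inner = real_normed_vector +
  fixes scaleC :: "complex \<Rightarrow> 'a \<Rightarrow> 'a"  (infixr \<open>*\<^sub>C\<close> 75)
    and cinner :: "'a \<Rightarrow> 'a \<Rightarrow> complex"
  assumes scaleC_add_right: "c *\<^sub>C (x + y) = c *\<^sub>C x + c *\<^sub>C y"
    and scaleC_add_left: "(c + d) *\<^sub>C x = c *\<^sub>C x + d *\<^sub>C x"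
    and scaleC_scaleC: "c *\<^sub>C (d *\<^sub>C x) = (c * d) *\<^sub>C x"
    and scaleC_one: "1 *\<^sub>C x = x"
    and scaleR_scaleC: "scaleR r x = complex_of_real r *\<^sub>C x"
    and cinner_commute: "cinner x y = cnj (cinner y x)"
    and cinner_add_left: "cinner (x + y) z = cinner x z + cinner y z"
    and cinner_scaleC_left: "cinner (c *\<^sub>C x) y = c * cinner x y"
    and cinner_self: "cinner x x = complex_of_real ((norm x)\<^sup>2)"

class complex_hilbert = complex_inner + complete_space

global_interpretation cvec: vector_space "scaleC :: complex \<Rightarrow> 'a \<Rightarrow> 'a::complex_inner"
  by standard (simp_all add: scaleC_add_right scaleC_add_left scaleC_scaleC scaleC_one)

definition infinite_cdim :: "'a::complex_inner set \<Rightarrow> bool"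
  where "infinite_cdim S \<longleftrightarrow> \<not> (\<exists>B. finite B \<and> S \<subseteq> cvec.span B)"


section \<open>Bounded operators, adjoints and unitary orbits\<close>

definition bounded_clinear :: "('a::complex_inner \<Rightarrow> 'a) \<Rightarrow> bool"
  where "bounded_clinear T \<longleftrightarrow> bounded_linear T \<and> (\<forall>c x. T (c *\<^sub>C x) = c *\<^sub>C T x)"

definition bounded_ops :: "('a::complex_inner \<Rightarrow> 'a) set"
  where "bounded_ops = {T. bounded_clinear T}"

text \<open>For bounded operators on a Hilbert space the description is proper, see
  \<open>cinner_cadjoint\<close> below.\<close>

definition cadjoint :: "('a::complex_inner \<Rightarrow> 'a) \<Rightarrow> 'a \<Rightarrow> 'a"
  where "cadjoint T = (THE S. \<forall>x y. cinner (S x) y = cinner x (T y))"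

definition unitary_op :: "('a::complex_inner \<Rightarrow> 'a) \<Rightarrow> bool"
  where "unitary_op W \<longleftrightarrow> bounded_clinear W \<and> cadjoint W \<circ> W = id \<and> W \<circ> cadjoint W = id"

definition unitary_orbit :: "('a::complex_inner \<Rightarrow> 'a) \<Rightarrow> ('a \<Rightarrow> 'a) set"
  where "unitary_orbit T = {cadjoint W \<circ> T \<circ> W | W. unitary_op W}"


section \<open>Minimal polynomials and eigenspaces\<close>

definition poly_op :: "complex poly \<Rightarrow> ('a::complex_inner \<Rightarrow> 'a) \<Rightarrow> 'a \<Rightarrow> 'a"
  where "poly_op p T = (\<lambda>x. \<Sum>i\<le>degree p. coeff p i *\<^sub>C (T ^^ i) x)"

text \<open>Stated as a relation, since an operator need not be algebraic.\<close>

definition is_minimal_poly :: "complex poly \<Rightarrow> ('a::complex_inner \<Rightarrow> 'a) \<Rightarrow> bool"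
  where "is_minimal_poly p T \<longleftrightarrow>
    lead_coeff p = 1 \<and> poly_op p T = (\<lambda>x. 0) \<and>
    (\<forall>q. q \<noteq> 0 \<and> poly_op q T = (\<lambda>x. 0) \<longrightarrow> degree p \<le> degree q)"

definition op_eigenspace :: "('a::complex_inner \<Rightarrow> 'a) \<Rightarrow> complex \<Rightarrow> 'a set"
  where "op_eigenspace T l = {x. T x = l *\<^sub>C x}"

definition op_eigenvalue :: "('a::complex_inner \<Rightarrow> 'a) \<Rightarrow> complex \<Rightarrow> bool"
  where "op_eigenvalue T l \<longleftrightarrow> (\<exists>x. x \<noteq> 0 \<and> T x = l *\<^sub>C x)"


section \<open>Generated algebras and the weak operator topology\<close>

text \<open>The identity is not adjoined. This makes no difference for an algebraic invertible generator:
  its minimal polynomial has nonzero constant term, so the identity is a polynomial without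
  constant term in it.\<close>

inductive_set op_algebra :: "('a::complex_inner \<Rightarrow> 'a) set \<Rightarrow> ('a \<Rightarrow> 'a) set"
  for G :: "('a \<Rightarrow> 'a) set" where
  gen: "T \<in> G \<Longrightarrow> T \<in> op_algebra G"
| zero: "(\<lambda>x. 0) \<in> op_algebra G"
| add: "S \<in> op_algebra G \<Longrightarrow> T \<in> op_algebra G \<Longrightarrow> (\<lambda>x. S x + T x) \<in> op_algebra G"
| scale: "T \<in> op_algebra G \<Longrightarrow> (\<lambda>x. c *\<^sub>C T x) \<in> op_algebra G"
| mult: "S \<in> op_algebra G \<Longrightarrow> T \<in> op_algebra G \<Longrightarrow> S \<circ> T \<in> op_algebra G"

text \<open>The coarsest topology on the bounded operators for which every
  \<open>T \<mapsto> cinner (T x) y\<close> is continuous.\<close>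

definition weak_op_topology :: "('a::complex_inner \<Rightarrow> 'a) topology"
  where "weak_op_topology =
    topology_generated_by {{T \<in> bounded_ops. cinner (T x) y \<in> D} | x y D. open D}"


section \<open>Sanity checks\<close>

lemma topspace_weak_op_topology: "topspace weak_op_topology = bounded_ops"
  unfolding weak_op_topology_def topology_generated_by_topspace by blast

lemma cinner_add_right: "cinner x (y + z) = cinner x y + cinner x z"
  by (metis cinner_add_left cinner_commute complex_cnj_add)

lemma cinner_scaleC_right: "cinner x (c *\<^sub>C y) = cnj c * cinner x y"
  by (metis cinner_commute cinner_scaleC_left complex_cnj_mult)

lemma cinner_minus_left: "cinner (x - y) z = cinner x z - cinner y z"
  by (metis add_diff_cancel diff_add_cancel cinner_add_left)

lemma cinner_ext:
  assumes "\<And>y. cinner x y = cinner x' y"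
  shows "x = x'"
proof -
  have "cinner (x - x') (x - x') = 0"
    using assms by (simp add: cinner_minus_left)
  then show ?thesis
    by (simp add: cinner_self)
qed

lemma norm_add_sq: "(norm (x + y))\<^sup>2 = (norm x)\<^sup>2 + 2 * Re (cinner x y) + (norm y)\<^sup>2"
proof -
  have "complex_of_real ((norm (x + y))\<^sup>2)
      = complex_of_real ((norm x)\<^sup>2) + cinner x y + cnj (cinner x y) + complex_of_real ((norm y)\<^sup>2)"
    unfolding cinner_self [symmetric]
    by (simp add: cinner_add_left cinner_add_right cinner_commute [of y x])
  then have "Re (complex_of_real ((norm (x + y))\<^sup>2))
      = Re (complex_of_real ((norm x)\<^sup>2) + cinner x y + cnj (cinner x y)
          + complex_of_real ((norm y)\<^sup>2))"
    by (rule arg_cong)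
  then show ?thesis
    by (simp del: of_real_power)
qed

lemma parallelogram:
  fixes x y :: "'a::complex_inner"
  shows "(norm (x + y))\<^sup>2 + (norm (x - y))\<^sup>2 = 2 * (norm x)\<^sup>2 + 2 * (norm y)\<^sup>2"
proof -
  have "cinner x (-y) = - cinner x y"
    using cinner_scaleC_right [of x "-1" y] scaleR_scaleC [of "-1" y] by simp
  then show ?thesis
    using norm_add_sq [of x y] norm_add_sq [of x "-y"] by simp
qed

lemma riesz:
  fixes f :: "'a::complex_hilbert \<Rightarrow> complex"
  assumes f: "bounded_linear f" and fC: "\<And>c x. f (c *\<^sub>C x) = c * f x"
  shows "\<exists>z. \<forall>x. f x = cinner x z"
proof -
  interpret f: bounded_linear f by fact
  obtain K where K: "K > 0" "\<And>x. norm (f x) \<le> norm x * K"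
    using f.pos_bounded by blast
  define J where "J x = (norm x)\<^sup>2 - 2 * Re (f x)" for x
  have low: "- K\<^sup>2 \<le> J x" for x
  proof -
    have "Re (f x) \<le> norm x * K"
      using K(2) [of x] abs_Re_le_cmod [of "f x"] by linarith
    moreover have "0 \<le> (norm x - K)\<^sup>2" by simp
    ultimately show ?thesis
      by (simp add: J_def power2_diff)
  qed
  define m where "m = Inf (range J)"
  have bdd: "bdd_below (range J)"
    using low by (meson bdd_belowI2)
  have m_le: "m \<le> J x" for x
    unfolding m_def by (rule cInf_lower) (use bdd in auto)
  have "\<exists>x. J x < m + 1 / real (Suc n)" for n
  proof -
    have "Inf (range J) < m + 1 / real (Suc n)"
      by (simp add: m_def)
    then show ?thesis
      by (subst (asm) cInf_less_iff) (use bdd in auto)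
  qed
  then obtain X where X: "\<And>n. J (X n) < m + 1 / real (Suc n)"
    by metis
  have par: "(norm (x - y))\<^sup>2 \<le> 2 * (J x - m) + 2 * (J y - m)" for x y
  proof -
    have "m \<le> J ((1/2) *\<^sub>R (x + y))" by (rule m_le)
    also have "\<dots> = (norm (x + y))\<^sup>2 / 4 - Re (f x) - Re (f y)"
      by (simp add: J_def f.scaleR f.add power_divide add_divide_distrib)
    finally show ?thesis
      using parallelogram [of x y] by (simp add: J_def)
  qed
  have "Cauchy X"
  proof (rule metric_CauchyI)
    fix e :: real assume "0 < e"
    then obtain N where N: "1 / real (Suc N) < e\<^sup>2 / 4"
      by (metis divide_pos_pos nat_approx_posE zero_less_numeral zero_less_power)
    have small: "J (X n) - m < e\<^sup>2 / 4" if "n \<ge> N" for n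
    proof -
      have "1 / real (Suc n) \<le> 1 / real (Suc N)"
        using that by (simp add: frac_le)
      then show ?thesis
        using X [of n] N by linarith
    qed
    have "dist (X p) (X q) < e" if "p \<ge> N" "q \<ge> N" for p q
    proof -
      have "(norm (X p - X q))\<^sup>2 < e\<^sup>2"
        using order_le_less_trans [OF par [of "X p" "X q"]
            add_strict_mono [OF mult_strict_left_mono [OF small [OF that(1)], of 2]
              mult_strict_left_mono [OF small [OF that(2)], of 2]]]
        by simp
      then show ?thesis
        using \<open>0 < e\<close> by (simp add: dist_norm power2_less_imp_less)
    qed
    then show "\<exists>N. \<forall>p\<ge>N. \<forall>q\<ge>N. dist (X p) (X q) < e"
      by blast
  qed
  then obtain z where z: "X \<longlonglongrightarrow> z"
    using Cauchy_convergent convergent_def by blast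
  have "(\<lambda>n. J (X n)) \<longlonglongrightarrow> J z"
    unfolding J_def by (intro tendsto_intros z f.tendsto)
  moreover have "(\<lambda>n. m + 1 / real (Suc n)) \<longlonglongrightarrow> m"
    using LIMSEQ_inverse_real_of_nat_add [of m] by (simp add: inverse_eq_divide)
  ultimately have "J z \<le> m"
    by (rule LIMSEQ_le) (use X less_imp_le in blast)
  then have min: "J z \<le> J x" for x
    using m_le [of x] by linarith
  have Re_eq: "Re (f x) = Re (cinner x z)" for x
  proof (rule ccontr)
    define d where "d = Re (cinner z x) - Re (f x)"
    assume "Re (f x) \<noteq> Re (cinner x z)"
    then have d: "d \<noteq> 0"
      using cinner_commute [of x z] by (simp add: d_def)
    have quad: "0 \<le> t\<^sup>2 * (norm x)\<^sup>2 + 2 * t * d" for t :: real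
    proof -
      have "J (z + t *\<^sub>R x) = J z + (t\<^sup>2 * (norm x)\<^sup>2 + 2 * t * d)"
        by (simp add: J_def norm_add_sq f.add f.scaleR d_def power_mult_distrib
            cinner_scaleC_right scaleR_scaleC [of t x, symmetric] algebra_simps)
          (simp add: scaleR_scaleC cinner_scaleC_right)
      then show ?thesis
        using min [of "z + t *\<^sub>R x"] by linarith
    qed
    define n2 where "n2 = (norm x)\<^sup>2 + 1"
    have n2: "n2 > 0" by (simp add: n2_def add_nonneg_pos)
    have "(d / n2)\<^sup>2 * (norm x)\<^sup>2 \<le> (d / n2)\<^sup>2 * n2"
      by (intro mult_left_mono) (simp_all add: n2_def)
    also have "\<dots> = d\<^sup>2 / n2"
      using n2 by (simp add: power2_eq_square)
    finally have "0 \<le> d\<^sup>2 / n2 + 2 * (- (d / n2)) * d"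
      using quad [of "- (d / n2)"] by simp
    also have "\<dots> = - (d\<^sup>2 / n2)"
      by (simp add: power2_eq_square)
    finally show False
      using d n2 by (simp add: divide_le_0_iff)
  qed
  have "f x = cinner x z" for x
    using Re_eq [of x] Re_eq [of "\<i> *\<^sub>C x"]
    by (simp add: fC cinner_scaleC_left complex_eq_iff)
  then show ?thesis by blast
qed

lemma norm_cinner_le: "norm (cinner x y) \<le> norm x * norm y"
proof (cases "y = 0")
  case True
  then show ?thesis
    using cinner_scaleC_right [of x 0 "0::'a"] by simp
next
  case False
  define c where "c = - (cinner x y / complex_of_real ((norm y)\<^sup>2))"
  have "(norm (c *\<^sub>C y))\<^sup>2 = (norm c)\<^sup>2 * (norm y)\<^sup>2"
  proof -
    have "complex_of_real ((norm (c *\<^sub>C y))\<^sup>2) = complex_of_real ((norm c)\<^sup>2 * (norm y)\<^sup>2)"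
      unfolding cinner_self [symmetric] of_real_mult complex_norm_square
      by (simp add: cinner_scaleC_left cinner_scaleC_right)
    then show ?thesis
      using of_real_eq_iff by blast
  qed
  then have "0 \<le> (norm x)\<^sup>2 + 2 * Re (cnj c * cinner x y) + (norm c)\<^sup>2 * (norm y)\<^sup>2"
    using norm_add_sq [of x "c *\<^sub>C y"] by (simp add: cinner_scaleC_right)
      (metis zero_le_power2)
  moreover have "cnj c * cinner x y = - complex_of_real ((norm (cinner x y))\<^sup>2 / (norm y)\<^sup>2)"
    using complex_norm_square [of "cinner x y"] by (simp add: c_def mult.commute)
  moreover have "(norm c)\<^sup>2 * (norm y)\<^sup>2 = (norm (cinner x y))\<^sup>2 / (norm y)\<^sup>2"
    using False by (simp add: c_def norm_divide norm_mult power_divide power2_eq_square)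
  ultimately have "(norm (cinner x y))\<^sup>2 / (norm y)\<^sup>2 \<le> (norm x)\<^sup>2"
    by (simp del: of_real_power of_real_divide)
  then have "(norm (cinner x y))\<^sup>2 \<le> (norm x * norm y)\<^sup>2"
    using False by (simp add: divide_le_eq power_mult_distrib)
  then show ?thesis
    by (rule power2_le_imp_le) simp
qed

lemma cinner_cadjoint:
  fixes T :: "'a::complex_hilbert \<Rightarrow> 'a"
  assumes "bounded_clinear T"
  shows "cinner (cadjoint T x) y = cinner x (T y)"
proof -
  interpret T: bounded_linear T
    using assms by (simp add: bounded_clinear_def)
  have TC: "T (c *\<^sub>C x) = c *\<^sub>C T x" for c x
    using assms by (simp add: bounded_clinear_def)
  have "\<exists>z. \<forall>y. cinner (T y) x = cinner y z" for x
  proof (rule riesz)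
    obtain K where K: "\<And>x. norm (T x) \<le> norm x * K"
      using T.bounded by blast
    show "bounded_linear (\<lambda>y. cinner (T y) x)"
    proof (rule bounded_linear_intro)
      show "norm (cinner (T y) x) \<le> norm y * (K * norm x)" for y
        using norm_cinner_le [of "T y" x] mult_right_mono [OF K [of y], of "norm x"]
        by (simp add: mult.assoc)
    qed (simp_all add: T.add T.scaleR cinner_add_left,
        simp add: scaleR_scaleC cinner_scaleC_left scaleR_conv_of_real)
  qed (simp add: TC cinner_scaleC_left)
  then obtain S where S: "\<And>x y. cinner (T y) x = cinner y (S x)"
    by metis
  have "\<forall>x y. cinner (cadjoint T x) y = cinner x (T y)"
    unfolding cadjoint_def
  proof (rule theI [of _ S])
    show "\<forall>x y. cinner (S x) y = cinner x (T y)"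
      using S cinner_commute by metis
    then show "S' = S" if "\<forall>x y. cinner (S' x) y = cinner x (T y)" for S'
      using that by (intro ext cinner_ext) simp
  qed
  then show ?thesis by blast
qed

end

theory Submission
  imports Defs "HOL-Computational_Algebra.Fundamental_Theorem_Algebra"
begin

text \<open>If \<open>U\<close> has a finite-dimensional eigenspace, or \<open>V\<close> two of them, then that operator is a scalar up
  to finite rank on the unitary orbit, while the other one is algebraic. So the orbit of the finite
  rank part under the other operator spans a finite-dimensional invariant subspace, and a vector
  orthogonal to it gives a weakly closed condition that excludes some rank one operator.

  Conversely, choose an orthonormal basis \<open>g n, h n\<close>. Let the spectral projection \<open>P\<close> of \<open>U0\<close> be the
  sum of the projections onto \<open>s n h n + t n g n\<close> with \<open>s n\<close> strictly decreasing, let the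
  \<open>g n\<close> span one eigenspace of \<open>V0\<close>, with projection \<open>Q0\<close>, and let the last eigenspace, with projection
  \<open>Q2\<close>, contain a vector \<open>v\<close> meeting every \<open>h n\<close>, all its other basis vectors being orthogonal to \<open>v\<close>
  and \<open>h 0\<close>. Then \<open>(1 - Q0) P (1 - Q0)\<close> is diagonal with distinct eigenvalues on the \<open>h n\<close>, so the
  algebra contains the projections onto the \<open>h n\<close> up to norm closure. Compressing \<open>Q2\<close> by them links
  \<open>h 0\<close> to every \<open>h n\<close>, and \<open>Q0 P\<close> links \<open>h n\<close> to \<open>g n\<close>. So all matrix units are obtained.\<close>

section \<open>Inner product calculus\<close>

text \<open>Since \<open>U0\<close> and \<open>V0\<close> are conjugated independently, only the
  multiplicities of the eigenvalues matter, and the converse is a choice of the relative position of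
  two orthonormal eigenbases. The obstacle is the remaining eigenspace of \<open>V\<close>, which is
  nonzero but of unknown dimension. So a single vector \<open>v\<close> of it has to do all the
  linking, and the vectors that fill up the rest of it must leave \<open>Q2 (h 0)\<close> a multiple
  of \<open>v\<close>, while infinitely many directions remain for the middle eigenspace. The strict
  monotonicity of \<open>s\<close> replaces a functional calculus: with the eigenvalues of the
  compression in decreasing order, powers of it peel off one rank one projection after the other, at
  geometric speed. Multiplication is not jointly continuous in the weak operator topology. Hence all
  products are formed in the operator norm closure of the algebra, which is again an algebra, and
  weak limits are taken only once, when every matrix unit is available.\<close>

lemmas scaleC_simps = cvec.scale_zero_left cvec.scale_zero_right cvec.scale_minus_left
  cvec.scale_minus_right scaleC_scaleC scaleC_one

lemma cinner_zero_left [simp]: "cinner 0 x = 0"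
  using cinner_minus_left [of x x x] by simp

lemma cinner_zero_right [simp]: "cinner x 0 = 0"
  using cinner_commute [of x 0] by simp

lemma cinner_minus_right: "cinner z (x - y) = cinner z x - cinner z y"
  by (metis cinner_commute cinner_minus_left complex_cnj_diff)

lemma cinner_uminus_left: "cinner (- x) y = - cinner x y"
  using cinner_minus_left [of 0 x y] by simp

lemma cinner_uminus_right: "cinner x (- y) = - cinner x y"
  using cinner_minus_right [of x 0 y] by simp

lemma cinner_sum_left: "cinner (\<Sum>i\<in>F. f i) y = (\<Sum>i\<in>F. cinner (f i) y)"
  by (induction F rule: infinite_finite_induct) (simp_all add: cinner_add_left)

lemma cinner_sum_right: "cinner y (\<Sum>i\<in>F. f i) = (\<Sum>i\<in>F. cinner y (f i))"
  by (induction F rule: infinite_finite_induct) (simp_all add: cinner_add_right)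

lemmas cinner_simps = cinner_add_left cinner_add_right cinner_scaleC_left cinner_scaleC_right
  cinner_minus_left cinner_minus_right cinner_uminus_left cinner_uminus_right

lemma cinner_self_eq_0 [simp]: "cinner x x = 0 \<longleftrightarrow> x = 0"
  by (simp add: cinner_self)

lemma cinner_eq_0_commute: "cinner x y = 0 \<longleftrightarrow> cinner y x = 0"
  by (metis cinner_commute complex_cnj_zero)

lemma norm_scaleC [simp]: "norm (c *\<^sub>C x) = norm c * norm x"
proof -
  have "complex_of_real ((norm (c *\<^sub>C x))\<^sup>2) = complex_of_real ((norm c * norm x)\<^sup>2)"
    unfolding cinner_self [symmetric] power_mult_distrib of_real_mult complex_norm_square
    by (simp add: cinner_simps)
  then have "(norm (c *\<^sub>C x))\<^sup>2 = (norm c * norm x)\<^sup>2"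
    using of_real_eq_iff by blast
  then show ?thesis
    by (simp add: power2_eq_iff_nonneg)
qed

lemma bounded_bilinear_cinner: "bounded_bilinear (cinner :: 'a::complex_inner \<Rightarrow> 'a \<Rightarrow> complex)"
proof
  show "\<exists>K. \<forall>a b :: 'a. norm (cinner a b) \<le> norm a * norm b * K"
    by (rule exI [of _ 1]) (simp add: norm_cinner_le)
qed (simp_all add: cinner_simps scaleR_scaleC scaleR_conv_of_real)

lemmas tendsto_cinner = bounded_bilinear.tendsto [OF bounded_bilinear_cinner]
lemmas bounded_linear_cinner_left = bounded_bilinear.bounded_linear_left [OF bounded_bilinear_cinner]

lemma bounded_linear_scaleC: "bounded_linear (\<lambda>x :: 'a::complex_inner. c *\<^sub>C x)"
proof (rule bounded_linear_intro)
  show "norm (c *\<^sub>C x) \<le> norm x * norm c" for x :: 'a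
    by (simp add: mult.commute)
qed (simp_all add: scaleC_add_right scaleR_scaleC scaleC_scaleC mult.commute)


section \<open>Bounded complex-linear operators\<close>

lemma bounded_clinear_add: "bounded_clinear T \<Longrightarrow> T (x + y) = T x + T y"
  by (simp add: bounded_clinear_def linear_simps)

lemma bounded_clinear_diff: "bounded_clinear T \<Longrightarrow> T (x - y) = T x - T y"
  by (simp add: bounded_clinear_def linear_simps)

lemma bounded_clinear_scaleC: "bounded_clinear T \<Longrightarrow> T (c *\<^sub>C x) = c *\<^sub>C T x"
  by (simp add: bounded_clinear_def)

lemma bounded_clinear_zero: "bounded_clinear T \<Longrightarrow> T 0 = 0"
  by (simp add: bounded_clinear_def linear_simps)

lemma bounded_clinear_minus: "bounded_clinear T \<Longrightarrow> T (- x) = - T x"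
  by (simp add: bounded_clinear_def linear_simps)

lemma bounded_clinear_sum: "bounded_clinear T \<Longrightarrow> T (\<Sum>i\<in>F. f i) = (\<Sum>i\<in>F. T (f i))"
  by (simp add: bounded_clinear_def bounded_linear.linear linear_sum)

lemmas bounded_clinear_simps = bounded_clinear_add bounded_clinear_diff bounded_clinear_scaleC
  bounded_clinear_zero bounded_clinear_minus

lemma bounded_clinearI:
  assumes "\<And>x y. T (x + y) = T x + T y" "\<And>c x. T (c *\<^sub>C x) = c *\<^sub>C T x"
    and "\<And>x. norm (T x) \<le> norm x * K"
  shows "bounded_clinear T"
  unfolding bounded_clinear_def
  by (intro conjI bounded_linear_intro [where K = K]) (auto simp: assms scaleR_scaleC)

lemma bounded_clinear_bound:
  assumes "bounded_clinear T"
  shows "\<exists>K>0. \<forall>x. norm (T x) \<le> K * norm x"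
  using assms bounded_linear.pos_bounded unfolding bounded_clinear_def
  by (metis mult.commute)

lemma bounded_clinear_const_zero: "bounded_clinear (\<lambda>x. 0)"
  by (simp add: bounded_clinear_def scaleC_simps)

lemma bounded_clinear_ident: "bounded_clinear (\<lambda>x. x)"
  by (simp add: bounded_clinear_def)

lemma bounded_clinear_plus:
  "bounded_clinear S \<Longrightarrow> bounded_clinear T \<Longrightarrow> bounded_clinear (\<lambda>x. S x + T x)"
  by (simp add: bounded_clinear_def bounded_linear_add scaleC_add_right)

lemma bounded_clinear_scale: "bounded_clinear T \<Longrightarrow> bounded_clinear (\<lambda>x. c *\<^sub>C T x)"
  unfolding bounded_clinear_def
  by (auto simp: bounded_linear_compose [OF bounded_linear_scaleC] scaleC_scaleC mult.commute)

lemma bounded_clinear_compose: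
  "bounded_clinear S \<Longrightarrow> bounded_clinear T \<Longrightarrow> bounded_clinear (S \<circ> T)"
  unfolding bounded_clinear_def
  by (auto simp: o_def bounded_linear_compose)

lemma bounded_clinear_sub:
  "bounded_clinear S \<Longrightarrow> bounded_clinear T \<Longrightarrow> bounded_clinear (\<lambda>x. S x - T x)"
  by (simp add: bounded_clinear_def bounded_linear_sub cvec.scale_right_diff_distrib)

lemma bounded_clinear_funpow: "bounded_clinear T \<Longrightarrow> bounded_clinear (T ^^ n)"
  by (induction n) (simp_all add: bounded_clinear_ident bounded_clinear_compose id_def)

text \<open>For members \<open>u\<close>, \<open>w\<close> of an orthonormal basis these are the
  matrix units.\<close>

definition rank_one :: "'a::complex_inner \<Rightarrow> 'a \<Rightarrow> 'a \<Rightarrow> 'a"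
  where "rank_one u w x = cinner x w *\<^sub>C u"

lemma bounded_clinear_rank_one: "bounded_clinear (rank_one u w)"
proof (rule bounded_clinearI)
  show "norm (rank_one u w x) \<le> norm x * (norm w * norm u)" for x
    using mult_right_mono [OF norm_cinner_le [of x w] norm_ge_zero [of u]]
    by (simp add: rank_one_def mult.assoc)
qed (simp_all add: rank_one_def cinner_simps scaleC_add_left scaleC_scaleC)

text \<open>Testing the adjoint against its own value bounds the square of
  \<open>norm (cadjoint T x)\<close> by \<open>norm x * K * norm (cadjoint T x)\<close>, and one
  factor cancels.\<close>

lemma bounded_clinear_cadjoint:
  fixes T :: "'a::complex_hilbert \<Rightarrow> 'a"
  assumes T: "bounded_clinear T"
  shows "bounded_clinear (cadjoint T)"
proof -
  obtain K where K: "K > 0" "\<And>x. norm (T x) \<le> K * norm x"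
    using bounded_clinear_bound [OF T] by blast
  show ?thesis
  proof (rule bounded_clinearI)
    fix x
    have "complex_of_real ((norm (cadjoint T x))\<^sup>2) = cinner x (T (cadjoint T x))"
      by (simp only: cinner_cadjoint [OF T] flip: cinner_self)
    then have "(norm (cadjoint T x))\<^sup>2 = norm (cinner x (T (cadjoint T x)))"
      by (metis abs_power2 norm_of_real)
    also have "\<dots> \<le> norm x * (K * norm (cadjoint T x))"
      by (meson K(2) mult_left_mono norm_cinner_le norm_ge_zero order_trans)
    finally have "norm (cadjoint T x) * norm (cadjoint T x) \<le> (norm x * K) * norm (cadjoint T x)"
      by (simp add: power2_eq_square mult.assoc)
    then show "norm (cadjoint T x) \<le> norm x * K"
      using K(1) by (cases "cadjoint T x = 0") auto
  qed (rule cinner_ext, simp add: cinner_cadjoint [OF T] cinner_simps)+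
qed

lemma unitary_cinner:
  fixes W :: "'a::complex_hilbert \<Rightarrow> 'a"
  assumes "unitary_op W"
  shows "cinner (W x) (W y) = cinner x y"
  using assms unfolding unitary_op_def
  by (metis cinner_cadjoint comp_apply id_apply)

lemma unitary_norm:
  fixes W :: "'a::complex_hilbert \<Rightarrow> 'a"
  assumes "unitary_op W"
  shows "norm (W x) = norm x"
proof -
  have "complex_of_real ((norm (W x))\<^sup>2) = complex_of_real ((norm x)\<^sup>2)"
    by (simp only: unitary_cinner [OF assms] flip: cinner_self)
  then have "(norm (W x))\<^sup>2 = (norm x)\<^sup>2"
    using of_real_eq_iff by blast
  then show ?thesis
    by simp
qed


section \<open>Orthonormal bases\<close>

definition orthonormal_on :: "'i set \<Rightarrow> ('i \<Rightarrow> 'a::complex_inner) \<Rightarrow> bool"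
  where "orthonormal_on I b \<longleftrightarrow> (\<forall>i\<in>I. \<forall>j\<in>I. cinner (b i) (b j) = (if i = j then 1 else 0))"

text \<open>Completeness is encoded as a trivial orthogonal complement instead of a dense span: this
  is what maximality of an orthonormal family gives, and it lets vectors be compared by
  coordinates.\<close>

definition orthonormal_basis :: "'i set \<Rightarrow> ('i \<Rightarrow> 'a::complex_inner) \<Rightarrow> bool"
  where "orthonormal_basis I b \<longleftrightarrow>
    orthonormal_on I b \<and> (\<forall>x. (\<forall>i\<in>I. cinner x (b i) = 0) \<longrightarrow> x = 0)"

lemma orthonormal_onD:
  "orthonormal_on I b \<Longrightarrow> i \<in> I \<Longrightarrow> j \<in> I \<Longrightarrow> cinner (b i) (b j) = (if i = j then 1 else 0)"
  by (simp add: orthonormal_on_def)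

lemma orthonormal_basis_orthonormal: "orthonormal_basis I b \<Longrightarrow> orthonormal_on I b"
  by (simp add: orthonormal_basis_def)

lemma orthonormal_basis_eqI:
  assumes "orthonormal_basis I b" and "\<And>i. i \<in> I \<Longrightarrow> cinner x (b i) = cinner y (b i)"
  shows "x = y"
proof -
  have "\<forall>i\<in>I. cinner (x - y) (b i) = 0"
    using assms(2) by (simp add: cinner_simps)
  then show ?thesis
    using assms(1) unfolding orthonormal_basis_def by (metis right_minus_eq)
qed

lemma norm_sum_orthonormal:
  assumes b: "orthonormal_on I b" and F: "finite F" "F \<subseteq> I"
  shows "(norm (\<Sum>i\<in>F. a i *\<^sub>C b i))\<^sup>2 = (\<Sum>i\<in>F. (norm (a i))\<^sup>2)"
proof -
  have "complex_of_real ((norm (\<Sum>i\<in>F. a i *\<^sub>C b i))\<^sup>2)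
      = (\<Sum>i\<in>F. \<Sum>j\<in>F. cnj (a i) * (a j * cinner (b j) (b i)))"
    unfolding cinner_self [symmetric] cinner_sum_left cinner_sum_right cinner_simps
      sum_distrib_left ..
  also have "\<dots> = (\<Sum>i\<in>F. \<Sum>j\<in>F. if i = j then a i * cnj (a i) else 0)"
    using F by (intro sum.cong refl) (auto simp: orthonormal_onD [OF b] subset_iff)
  also have "\<dots> = complex_of_real (\<Sum>i\<in>F. (norm (a i))\<^sup>2)"
    using F by (simp add: complex_norm_square del: of_real_power)
  finally show ?thesis
    using of_real_eq_iff by blast
qed

lemma bessel:
  assumes b: "orthonormal_on I b" and F: "finite F" "F \<subseteq> I"
  shows "(\<Sum>i\<in>F. (norm (cinner x (b i)))\<^sup>2) \<le> (norm x)\<^sup>2"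
proof -
  define s where "s = (\<Sum>i\<in>F. cinner x (b i) *\<^sub>C b i)"
  have "cinner x s = (\<Sum>i\<in>F. cnj (cinner x (b i)) * cinner x (b i))"
    by (simp add: s_def cinner_sum_right cinner_simps)
  also have "\<dots> = complex_of_real (\<Sum>i\<in>F. (norm (cinner x (b i)))\<^sup>2)"
    by (simp add: complex_norm_square mult.commute del: of_real_power)
  finally have "Re (cinner x s) = (\<Sum>i\<in>F. (norm (cinner x (b i)))\<^sup>2)"
    by simp
  moreover have "(norm s)\<^sup>2 = (\<Sum>i\<in>F. (norm (cinner x (b i)))\<^sup>2)"
    unfolding s_def by (rule norm_sum_orthonormal [OF b F])
  \<comment> \<open>Bessel's inequality is the expansion of this square; the form
    \<open>x + (- s)\<close> fits \<open>norm_add_sq\<close>.\<close>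
  moreover have "0 \<le> (norm (x + (- s)))\<^sup>2"
    by simp
  ultimately show ?thesis
    unfolding norm_add_sq by (simp add: cinner_simps)
qed

lemma bessel_summable:
  assumes b: "orthonormal_on I b"
  shows "(\<lambda>i. (norm (cinner x (b i)))\<^sup>2) summable_on I"
proof (rule nonneg_bdd_above_summable_on)
  show "bdd_above (sum (\<lambda>i. (norm (cinner x (b i)))\<^sup>2) ` {F. F \<subseteq> I \<and> finite F})"
    using bessel [OF b] by (intro bdd_aboveI2 [where M = "(norm x)\<^sup>2"]) auto
qed simp

lemma square_summable_orthonormal:
  fixes b :: "'i \<Rightarrow> 'a::complex_hilbert"
  assumes b: "orthonormal_on I b" and a: "(\<lambda>i. (norm (a i))\<^sup>2) summable_on I"
  shows "(\<lambda>i. a i *\<^sub>C b i) summable_on I"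
proof -
  let ?s = "\<lambda>F. \<Sum>i\<in>F. a i *\<^sub>C b i" and ?q = "\<lambda>F. \<Sum>i\<in>F. (norm (a i))\<^sup>2"
  have "\<exists>P. eventually P (finite_subsets_at_top I) \<and> (\<forall>F F'. P F \<and> P F' \<longrightarrow> dist (?s F) (?s F') < e)"
    if "e > 0" for e
  proof -
    define L where "L = infsum (\<lambda>i. (norm (a i))\<^sup>2) I"
    have le_L: "?q F \<le> L" if "finite F" "F \<subseteq> I" for F
      unfolding L_def using a that by (intro finite_sum_le_infsum) auto
    obtain F0 where F0: "finite F0" "F0 \<subseteq> I" "dist (?q F0) L \<le> (e / 3)\<^sup>2"
      using infsum_finite_approximation [OF a, of "(e / 3)\<^sup>2"] \<open>e > 0\<close> unfolding L_def by auto
    \<comment> \<open>Two large finite sets are compared through the common subset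
      \<open>F0\<close>, because Pythagoras applies to the honest difference \<open>F - F0\<close>.
      Two errors of \<open>e / 3\<close> stay strictly below \<open>e\<close>.\<close>
    have close: "dist (?s F) (?s F0) \<le> e / 3" if F: "finite F" "F0 \<subseteq> F" "F \<subseteq> I" for F
    proof -
      have "(dist (?s F) (?s F0))\<^sup>2 = (norm (?s (F - F0)))\<^sup>2"
        using F by (simp add: dist_norm sum_diff)
      also have "\<dots> = ?q (F - F0)"
        using F by (intro norm_sum_orthonormal [OF b]) auto
      also have "\<dots> = ?q F - ?q F0"
        using F by (simp add: sum_diff)
      also have "\<dots> \<le> (e / 3)\<^sup>2"
        using F0(3) le_L [OF F(1,3)] by (simp add: dist_real_def)
      finally show ?thesis
        by (rule power2_le_imp_le) (use \<open>e > 0\<close> in simp)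
    qed
    show ?thesis
    proof (intro exI conjI allI impI)
      show "\<forall>\<^sub>F F in finite_subsets_at_top I. finite F \<and> F0 \<subseteq> F \<and> F \<subseteq> I"
        using F0 unfolding eventually_finite_subsets_at_top by blast
      show "dist (?s F) (?s F') < e"
        if "(finite F \<and> F0 \<subseteq> F \<and> F \<subseteq> I) \<and> (finite F' \<and> F0 \<subseteq> F' \<and> F' \<subseteq> I)" for F F'
        using close [of F] close [of F'] that \<open>e > 0\<close> dist_triangle2 [of "?s F" "?s F'" "?s F0"]
        by linarith
    qed
  qed
  then have "cauchy_filter (filtermap ?s (finite_subsets_at_top I))"
    by (simp add: cauchy_filter_metric_filtermap)
  moreover have "complete (UNIV::'a set)"
    by (meson Cauchy_convergent UNIV_I complete_def convergent_def)
  ultimately obtain y where "(?s \<longlongrightarrow> y) (finite_subsets_at_top I)"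
    using complete_uniform[where S=UNIV] by (force simp add: filterlim_def)
  then show ?thesis
    using summable_on_def has_sum_def by blast
qed

lemma cinner_has_sum_orthonormal:
  assumes b: "orthonormal_on I b" and y: "((\<lambda>i. a i *\<^sub>C b i) has_sum y) I" and j: "j \<in> I"
  shows "cinner y (b j) = a j"
proof -
  have "((\<lambda>i. cinner (a i *\<^sub>C b i) (b j)) has_sum cinner y (b j)) I"
    by (rule has_sum_bounded_linear [OF bounded_linear_cinner_left y])
  then have "((\<lambda>i. if i = j then a j else 0) has_sum cinner y (b j)) I"
    by (rule has_sum_cong [THEN iffD1, rotated])
      (use orthonormal_onD [OF b] j in \<open>simp add: cinner_simps\<close>)
  moreover have "((\<lambda>i. if i = j then a j else 0) has_sum a j) I"
    by (rule has_sum_finite_neutralI [of "{j}"]) (use j in auto)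
  ultimately show ?thesis
    by (rule has_sum_unique)
qed

text \<open>The means of prescribing coordinates, for the unitary between two bases and for the
  coupling vector.\<close>

lemma riesz_fischer:
  fixes b :: "'i \<Rightarrow> 'a::complex_hilbert"
  assumes b: "orthonormal_on I b" and a: "(\<lambda>i. (norm (a i))\<^sup>2) summable_on I"
  obtains y where "\<And>i. i \<in> I \<Longrightarrow> cinner y (b i) = a i"
  using square_summable_orthonormal [OF assms] cinner_has_sum_orthonormal [OF b]
  unfolding summable_on_def by metis

lemma fourier_expansion:
  fixes b :: "'i \<Rightarrow> 'a::complex_hilbert"
  assumes b: "orthonormal_basis I b"
  shows "((\<lambda>i. cinner x (b i) *\<^sub>C b i) has_sum x) I"
proof -
  note ob = orthonormal_basis_orthonormal [OF b]
  obtain y where y: "((\<lambda>i. cinner x (b i) *\<^sub>C b i) has_sum y) I"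
    using square_summable_orthonormal [OF ob bessel_summable [OF ob]]
    unfolding summable_on_def by blast
  then have "y = x"
    using cinner_has_sum_orthonormal [OF ob y] by (intro orthonormal_basis_eqI [OF b])
  then show ?thesis
    using y by simp
qed

lemma parseval:
  fixes b :: "'i \<Rightarrow> 'a::complex_hilbert"
  assumes b: "orthonormal_basis I b"
  shows "((\<lambda>i. cinner x (b i) * cnj (cinner y (b i))) has_sum cinner x y) I"
proof -
  have "((\<lambda>i. cinner (cinner x (b i) *\<^sub>C b i) y) has_sum cinner x y) I"
    by (rule has_sum_bounded_linear [OF bounded_linear_cinner_left fourier_expansion [OF b]])
  moreover have "cinner (cinner x (b i) *\<^sub>C b i) y = cinner x (b i) * cnj (cinner y (b i))" for i
    by (metis cinner_commute cinner_scaleC_left)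
  ultimately show ?thesis
    by simp
qed

lemma parseval_norm:
  fixes b :: "'i \<Rightarrow> 'a::complex_hilbert"
  assumes b: "orthonormal_basis I b"
  shows "((\<lambda>i. (norm (cinner x (b i)))\<^sup>2) has_sum (norm x)\<^sup>2) I"
proof -
  have "((\<lambda>i. Re (cinner x (b i) * cnj (cinner x (b i)))) has_sum Re (cinner x x)) I"
    by (rule has_sum_bounded_linear [OF bounded_linear_Re parseval [OF b]])
  then show ?thesis
    by (simp add: cinner_self complex_norm_square [symmetric] del: of_real_power)
qed

text \<open>\<open>W\<close> transports coordinates from \<open>b\<close> to \<open>c\<close> and
  \<open>W'\<close> transports them back. Parseval makes \<open>W\<close> isometric, so its inverse
  \<open>W'\<close> is its adjoint.\<close>

lemma unitary_between_bases:
  fixes b c :: "'i \<Rightarrow> 'a::complex_hilbert"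
  assumes b: "orthonormal_basis I b" and c: "orthonormal_basis I c"
  obtains W where "unitary_op W" "\<And>i. i \<in> I \<Longrightarrow> W (b i) = c i"
proof -
  \<comment> \<open>Stated for an arbitrary pair of bases, since it is used in both
    directions.\<close>
  have "\<exists>W. \<forall>x. \<forall>i\<in>I. cinner (W x) (c i) = cinner x (b i)"
    if b: "orthonormal_basis I b" and c: "orthonormal_basis I c" for b c :: "'i \<Rightarrow> 'a"
  proof (rule choice, rule allI)
    fix x
    show "\<exists>y. \<forall>i\<in>I. cinner y (c i) = cinner x (b i)"
      by (rule riesz_fischer [OF orthonormal_basis_orthonormal [OF c]
          bessel_summable [OF orthonormal_basis_orthonormal [OF b], of x]]) blast
  qed
  then obtain W W' where W: "\<And>x i. i \<in> I \<Longrightarrow> cinner (W x) (c i) = cinner x (b i)"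
      and W': "\<And>x i. i \<in> I \<Longrightarrow> cinner (W' x) (b i) = cinner x (c i)"
    using b c by metis
  have WW': "W (W' x) = x" and W'W: "W' (W x) = x" for x
    by (rule orthonormal_basis_eqI [OF c], simp add: W W',
      rule orthonormal_basis_eqI [OF b], simp add: W W')
  have iso: "cinner (W x) (W y) = cinner x y" for x y
  proof -
    have "((\<lambda>i. cinner x (b i) * cnj (cinner y (b i))) has_sum cinner (W x) (W y)) I"
      using parseval [OF c, of "W x" "W y"]
      by (rule has_sum_cong [THEN iffD1, rotated]) (simp add: W)
    then show ?thesis
      using parseval [OF b] has_sum_unique by blast
  qed
  have bW: "bounded_clinear W"
  proof (rule bounded_clinearI)
    fix x
    have "(norm (W x))\<^sup>2 = (norm x)\<^sup>2"
      using iso [of x x] unfolding cinner_self using of_real_eq_iff by blast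
    then show "norm (W x) \<le> norm x * 1"
      by simp
  qed (rule orthonormal_basis_eqI [OF c], simp add: W cinner_simps)+
  have "cadjoint W = W'"
    by (intro ext cinner_ext) (metis WW' cinner_cadjoint [OF bW] iso)
  then have "unitary_op W"
    unfolding unitary_op_def using bW WW' W'W by auto
  moreover have "W (b i) = c i" if "i \<in> I" for i
    using that orthonormal_onD [OF orthonormal_basis_orthonormal [OF b]]
      orthonormal_onD [OF orthonormal_basis_orthonormal [OF c]]
    by (intro orthonormal_basis_eqI [OF c]) (simp add: W)
  ultimately show ?thesis
    using that by blast
qed


section \<open>Orthonormal bases of subspaces\<close>

definition orthonormal_basis_of :: "'a::complex_inner set \<Rightarrow> 'i set \<Rightarrow> ('i \<Rightarrow> 'a) \<Rightarrow> bool"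
  where "orthonormal_basis_of S I b \<longleftrightarrow>
    orthonormal_on I b \<and> b ` I \<subseteq> S \<and> (\<forall>x\<in>S. (\<forall>i\<in>I. cinner x (b i) = 0) \<longrightarrow> x = 0)"

text \<open>Zorn's lemma for orthonormal subsets of \<open>S\<close> above \<open>B0\<close>, each
  set being indexed by itself. A nonzero vector of \<open>S\<close> orthogonal to a maximal set
  could be normalised and adjoined.\<close>

lemma maximal_orthonormal:
  fixes S :: "'a::complex_inner set"
  assumes B0: "orthonormal_on B0 (\<lambda>x. x)" "B0 \<subseteq> S" and S: "cvec.subspace S"
  obtains B where "B0 \<subseteq> B" "orthonormal_basis_of S B (\<lambda>x. x)"
proof -
  define \<A> where "\<A> = {B. B0 \<subseteq> B \<and> B \<subseteq> S \<and> orthonormal_on B (\<lambda>x. x)}"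
  have "\<exists>M\<in>\<A>. \<forall>X\<in>\<A>. M \<subseteq> X \<longrightarrow> X = M"
  proof (rule subset_Zorn_nonempty)
    show "\<A> \<noteq> {}"
      using B0 by (auto simp: \<A>_def)
    fix \<C> assume \<C>: "\<C> \<noteq> {}" "subset.chain \<A> \<C>"
    have "orthonormal_on (\<Union>\<C>) (\<lambda>x. x)"
      unfolding orthonormal_on_def
    proof (intro ballI)
      fix x y assume "x \<in> \<Union>\<C>" "y \<in> \<Union>\<C>"
      then obtain X Y where XY: "X \<in> \<C>" "x \<in> X" "Y \<in> \<C>" "y \<in> Y" by blast
      then obtain Z where Z: "Z \<in> \<C>" "x \<in> Z" "y \<in> Z"
        using \<C>(2) unfolding subset_chain_def by blast
      then have "orthonormal_on Z (\<lambda>x. x)"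
        using \<C>(2) unfolding subset_chain_def \<A>_def by blast
      then show "cinner x y = (if x = y then 1 else 0)"
        using Z by (simp add: orthonormal_on_def)
    qed
    moreover have "B0 \<subseteq> \<Union>\<C>" "\<Union>\<C> \<subseteq> S"
      using \<C> unfolding subset_chain_def \<A>_def by blast+
    ultimately show "\<Union>\<C> \<in> \<A>"
      by (simp add: \<A>_def)
  qed
  then obtain B where "B \<in> \<A>" and max: "\<And>X. X \<in> \<A> \<Longrightarrow> B \<subseteq> X \<Longrightarrow> X = B"
    by auto
  then have B: "B0 \<subseteq> B" "B \<subseteq> S" "orthonormal_on B (\<lambda>x. x)"
    by (simp_all add: \<A>_def)
  have "x = 0" if x: "x \<in> S" and perp: "\<forall>b\<in>B. cinner x b = 0" for x
  proof (rule ccontr)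
    assume "x \<noteq> 0"
    define u where "u = complex_of_real (1 / norm x) *\<^sub>C x"
    have u: "u \<in> S" "\<forall>b\<in>B. cinner u b = 0"
      using x S perp by (auto simp: u_def cvec.subspace_scale cinner_simps)
    have "norm u = 1"
      using \<open>x \<noteq> 0\<close> by (simp add: u_def norm_divide)
    then have uu: "cinner u u = 1"
      by (simp add: cinner_self)
    have "orthonormal_on (insert u B) (\<lambda>x. x)"
      using B(3) u(2) uu unfolding orthonormal_on_def
      by (auto simp: cinner_eq_0_commute [of _ u])
    then have "insert u B = B"
      using B u(1) by (intro max) (auto simp: \<A>_def)
    then have "cinner u u = 0"
      using u(2) by blast
    then show False
      using uu by simp
  qed
  then have "orthonormal_basis_of S B (\<lambda>x. x)"
    using B by (simp add: orthonormal_basis_of_def)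
  then show ?thesis
    using that B(1) by blast
qed

text \<open>Distinct members are at distance sqrt 2, so points of a countable dense set chosen
  within 1/2 of them are distinct.\<close>

lemma orthonormal_countable:
  fixes B :: "'a::complex_inner set"
  assumes sep: "separable_space (euclidean :: 'a topology)" and B: "orthonormal_on B (\<lambda>x. x)"
  shows "countable B"
proof -
  obtain C :: "'a set" where C: "countable C" "closure C = UNIV"
    using sep by (auto simp: separable_space_def)
  have "\<exists>c\<in>C. dist c b < 1 / 2" for b
    using C(2) closure_approachable [of b C] by (metis UNIV_I half_gt_zero_iff zero_less_one)
  then obtain f where f: "\<And>b. f b \<in> C" "\<And>b. dist (f b) b < 1 / 2"
    by metis
  have "inj_on f B"
  proof (rule inj_onI, rule ccontr)
    fix x y assume xy: "x \<in> B" "y \<in> B" "f x = f y" "x \<noteq> y"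
    have "(norm (x + - y))\<^sup>2 = 2"
    proof -
      have "cinner x x = 1" "cinner y y = 1" "cinner x y = 0"
        using B xy by (auto simp: orthonormal_on_def)
      then have "norm x = 1" "norm y = 1"
        by (simp_all add: cinner_self power2_eq_1_iff del: of_real_power) (smt (verit) norm_ge_zero)+
      then show ?thesis
        unfolding norm_add_sq using \<open>cinner x y = 0\<close> by (simp add: cinner_simps)
    qed
    moreover have "norm (x + - y) < 1"
      using f(2) [of x] f(2) [of y] xy(3) dist_triangle3 [of x y "f x"] by (simp add: dist_norm)
    then have "(norm (x + - y))\<^sup>2 < 1"
      by (simp add: abs_square_less_1)
    ultimately show False
      by simp
  qed
  moreover have "countable (f ` B)"
    using C(1) f(1) by (meson countable_subset image_subsetI)
  ultimately show ?thesis
    using countable_image_inj_on by blast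
qed

lemma orthonormal_basis_of_reindex:
  assumes "orthonormal_basis_of S B (\<lambda>x. x)" and "bij_betw f I B"
  shows "orthonormal_basis_of S I f"
proof -
  have "f ` I = B" "inj_on f I"
    using assms(2) by (auto simp: bij_betw_def)
  then show ?thesis
    using assms(1) unfolding orthonormal_basis_of_def orthonormal_on_def
    by (auto simp: inj_on_eq_iff)
qed

lemma orthonormal_basis_of_finite_span:
  assumes S: "cvec.subspace S" and b: "orthonormal_basis_of S B (\<lambda>x. x)" and "finite B"
  shows "S \<subseteq> cvec.span B"
proof
  fix x assume x: "x \<in> S"
  define y where "y = (\<Sum>c\<in>B. cinner x c *\<^sub>C c)"
  have B: "B \<subseteq> S" "orthonormal_on B (\<lambda>x. x)"
    using b by (auto simp: orthonormal_basis_of_def)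
  have "cinner y c = cinner x c" if "c \<in> B" for c
  proof -
    have "cinner y c = (\<Sum>d\<in>B. if d = c then cinner x c else 0)"
      unfolding y_def cinner_sum_left
      using that orthonormal_onD [OF B(2)] by (intro sum.cong) (auto simp: cinner_simps)
    then show ?thesis
      using that \<open>finite B\<close> by simp
  qed
  moreover have "y \<in> S"
    unfolding y_def using B S by (intro cvec.subspace_sum cvec.subspace_scale) auto
  ultimately have "x - y \<in> S" "\<forall>c\<in>B. cinner (x - y) c = 0"
    using x S by (simp_all add: cinner_simps cvec.subspace_diff)
  then have "x - y = 0"
    using b unfolding orthonormal_basis_of_def by blast
  moreover have "y \<in> cvec.span B"
    unfolding y_def by (intro cvec.span_sum cvec.span_scale cvec.span_base)
  ultimately show "x \<in> cvec.span B"
    by simp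
qed

lemma infinite_orthonormal_basis:
  fixes S :: "'a::complex_inner set"
  assumes sep: "separable_space (euclidean :: 'a topology)" and S: "cvec.subspace S"
    and inf: "infinite_cdim S"
  obtains b :: "nat \<Rightarrow> 'a" where "orthonormal_basis_of S UNIV b"
proof -
  obtain B where B: "orthonormal_basis_of S B (\<lambda>x. x)"
    by (rule maximal_orthonormal [of "{}", OF _ _ S]) (auto simp: orthonormal_on_def)
  then have "infinite B"
    using orthonormal_basis_of_finite_span [OF S B] inf by (auto simp: infinite_cdim_def)
  moreover have "countable B"
    using B orthonormal_countable [OF sep] by (simp add: orthonormal_basis_of_def)
  ultimately show ?thesis
    using orthonormal_basis_of_reindex [OF B] bij_betw_from_nat_into that by blast
qed

text \<open>The family \<open>z\<close> forces the basis to be infinite. The basis contains its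
  members but is enumerated afresh, so the conclusion does not mention \<open>z\<close>.\<close>

lemma infinite_orthonormal_basis_extending:
  fixes S :: "'a::complex_inner set" and z :: "nat \<Rightarrow> 'a"
  assumes sep: "separable_space (euclidean :: 'a topology)" and S: "cvec.subspace S"
    and z: "orthonormal_on UNIV z" "range z \<subseteq> S"
  obtains b :: "nat \<Rightarrow> 'a" where "orthonormal_basis_of S UNIV b"
proof -
  have zz: "cinner (z i) (z j) = (if i = j then 1 else 0)" for i j
    using z(1) by (simp add: orthonormal_on_def)
  have "inj z"
    by (rule injI) (metis zz zero_neq_one)
  have "orthonormal_on (range z) (\<lambda>x. x)"
    unfolding orthonormal_on_def using \<open>inj z\<close> by (auto simp: zz inj_eq)
  then obtain B where B: "range z \<subseteq> B" "orthonormal_basis_of S B (\<lambda>x. x)"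
    using maximal_orthonormal [OF _ z(2) S] by blast
  then have "infinite B"
    using \<open>inj z\<close> by (meson finite_subset range_inj_infinite)
  moreover have "countable B"
    using B orthonormal_countable [OF sep] by (simp add: orthonormal_basis_of_def)
  ultimately show ?thesis
    using orthonormal_basis_of_reindex [OF B(2)] bij_betw_from_nat_into that by blast
qed

text \<open>Meant for the third eigenspace of \<open>V\<close>, whose dimension may be finite or
  infinite. The index 0 is reserved for the coupling vector.\<close>

lemma nontrivial_orthonormal_basis:
  fixes S :: "'a::complex_inner set"
  assumes sep: "separable_space (euclidean :: 'a topology)" and S: "cvec.subspace S"
    and "x \<in> S" "x \<noteq> 0"
  obtains J :: "nat set" and b :: "nat \<Rightarrow> 'a" where "0 \<in> J" "orthonormal_basis_of S J b"
proof -
  obtain B where B: "orthonormal_basis_of S B (\<lambda>x. x)"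
    by (rule maximal_orthonormal [of "{}", OF _ _ S]) (auto simp: orthonormal_on_def)
  have "countable B"
    using B orthonormal_countable [OF sep] by (simp add: orthonormal_basis_of_def)
  then obtain f :: "nat \<Rightarrow> 'a" and J where fJ: "bij_betw f J B"
    and J: "J = UNIV \<or> (\<exists>n. J = {..<n})"
    using countableE_infinite [of B] to_nat_on_finite bij_betw_from_nat_into [of B]
      ex_bij_betw_nat_finite [of B] by (metis atLeast0LessThan)
  have "J \<noteq> {}"
    using B fJ \<open>x \<in> S\<close> \<open>x \<noteq> 0\<close> by (auto simp: orthonormal_basis_of_def bij_betw_def)
  then have "0 \<in> J"
    using J by auto
  then show ?thesis
    using orthonormal_basis_of_reindex [OF B fJ] that by blast
qed


section \<open>Density in the weak operator topology\<close>

text \<open>An arbitrary filter is allowed because finite compressions of an operator form a net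
  over finite index sets. The hypothesis \<open>lim\<close> handles subbasic neighbourhoods, and
  induction over the generated topology handles the others.\<close>

lemma weak_op_closureI:
  assumes X: "X \<subseteq> bounded_ops" "T \<in> bounded_ops" and "F \<noteq> bot" and S: "\<And>n. S n \<in> X"
    and lim: "\<And>x y. ((\<lambda>n. cinner (S n x) y) \<longlongrightarrow> cinner (T x) y) F"
  shows "T \<in> weak_op_topology closure_of X"
proof -
  have ev: "\<forall>\<^sub>F n in F. S n \<in> O'"
    if "generate_topology_on {{T \<in> bounded_ops. cinner (T x) y \<in> D} | x y D. open D} O'" "T \<in> O'"
    for O'
    using that
  proof (induction rule: generate_topology_on.induct)
    case (Int a b)
    then show ?case
      by (auto intro: eventually_conj)
  next
    case (UN K)
    then obtain k where "k \<in> K" "T \<in> k" by blast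
    then have "\<forall>\<^sub>F n in F. S n \<in> k"
      using UN by blast
    then show ?case
      by (rule eventually_mono) (use \<open>k \<in> K\<close> in blast)
  next
    case (Basis s)
    then obtain x y D where s: "s = {T \<in> bounded_ops. cinner (T x) y \<in> D}" "open D"
      by blast
    then have "\<forall>\<^sub>F n in F. cinner (S n x) y \<in> D"
      using Basis(2) lim [of x y] by (auto simp: tendsto_def)
    then show ?case
      by (rule eventually_mono) (use S X s in auto)
  qed simp
  have "\<exists>A\<in>X. A \<in> O'" if O': "T \<in> O'" "openin weak_op_topology O'" for O'
  proof -
    have "\<forall>\<^sub>F n in F. S n \<in> O'"
      using ev [OF openin_topology_generated_by O'(1)] O'(2) by (simp add: weak_op_topology_def)
    then show ?thesis
      using \<open>F \<noteq> bot\<close> S eventually_happens' by blast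
  qed
  then show ?thesis
    using X(2) by (auto simp: in_closure_of topspace_weak_op_topology)
qed

lemma op_algebra_bounded: "G \<subseteq> bounded_ops \<Longrightarrow> op_algebra G \<subseteq> bounded_ops"
proof
  fix T assume "G \<subseteq> bounded_ops" "T \<in> op_algebra G"
  from this(2) show "T \<in> bounded_ops"
    by induction (use \<open>G \<subseteq> bounded_ops\<close> bounded_clinear_compose in \<open>auto simp: bounded_ops_def
        bounded_clinear_const_zero bounded_clinear_plus bounded_clinear_scale simp del: o_apply\<close>)
qed

section \<open>The operator norm closure of the generated algebra\<close>

definition uniform_closure :: "('a::complex_inner \<Rightarrow> 'a) set \<Rightarrow> ('a \<Rightarrow> 'a) set"
  where "uniform_closure X =
    {T \<in> bounded_ops. \<forall>e>0. \<exists>S\<in>X. \<forall>x. norm (T x - S x) \<le> e * norm x}"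

lemma uniform_closure_superset: "X \<subseteq> bounded_ops \<Longrightarrow> X \<subseteq> uniform_closure X"
proof
  fix T assume "X \<subseteq> bounded_ops" "T \<in> X"
  then have "\<exists>S\<in>X. \<forall>x. norm (T x - S x) \<le> e * norm x" if "e > 0" for e
    using that by (intro bexI [of _ T]) auto
  then show "T \<in> uniform_closure X"
    using \<open>X \<subseteq> bounded_ops\<close> \<open>T \<in> X\<close> by (auto simp: uniform_closure_def)
qed

lemma uniform_closure_subset_weak_closure:
  fixes X :: "('a::complex_inner \<Rightarrow> 'a) set"
  assumes X: "X \<subseteq> bounded_ops"
  shows "uniform_closure X \<subseteq> weak_op_topology closure_of X"
proof
  fix T assume T: "T \<in> uniform_closure X"
  have "\<exists>S\<in>X. \<forall>x. norm (T x - S x) \<le> (1 / real (Suc n)) * norm x" for n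
    using T unfolding uniform_closure_def by (smt (verit) mem_Collect_eq of_nat_0_less_iff zero_less_Suc zero_less_divide_1_iff)
  then obtain S where S: "\<And>n. S n \<in> X" "\<And>n x. norm (T x - S n x) \<le> (1 / real (Suc n)) * norm x"
    by metis
  show "T \<in> weak_op_topology closure_of X"
  proof (rule weak_op_closureI [OF X _ sequentially_bot S(1)])
    fix x y :: 'a
    have "(\<lambda>n. inverse (real (Suc n)) * norm x) \<longlonglongrightarrow> 0 * norm x"
      by (rule tendsto_mult [OF LIMSEQ_inverse_real_of_nat tendsto_const])
    then have "(\<lambda>n. inverse (real (Suc n)) * norm x) \<longlonglongrightarrow> 0"
      by simp
    moreover have "\<forall>\<^sub>F n in sequentially. norm (T x - S n x) \<le> inverse (real (Suc n)) * norm x"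
      using S(2) by (simp add: inverse_eq_divide)
    ultimately have "(\<lambda>n. T x - S n x) \<longlonglongrightarrow> 0"
      by (rule Lim_null_comparison [rotated])
    from tendsto_diff [OF tendsto_const [of "T x"] this] have "(\<lambda>n. S n x) \<longlonglongrightarrow> T x"
      by simp
    then show "(\<lambda>n. cinner (S n x) y) \<longlonglongrightarrow> cinner (T x) y"
      by (intro tendsto_cinner tendsto_const)
  qed (use T in \<open>simp add: uniform_closure_def\<close>)
qed

context
  fixes G :: "('a::complex_inner \<Rightarrow> 'a) set"
  assumes G: "G \<subseteq> bounded_ops"
begin

lemma uniform_closure_zero: "(\<lambda>x. 0) \<in> uniform_closure (op_algebra G)"
  using uniform_closure_superset [OF op_algebra_bounded [OF G]] op_algebra.zero by blast

lemma uniform_closure_add: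
  assumes S: "S \<in> uniform_closure (op_algebra G)" and T: "T \<in> uniform_closure (op_algebra G)"
  shows "(\<lambda>x. S x + T x) \<in> uniform_closure (op_algebra G)"
proof -
  have "\<exists>A\<in>op_algebra G. \<forall>x. norm (S x + T x - A x) \<le> e * norm x" if "e > 0" for e
  proof -
    obtain S' T' where S': "S' \<in> op_algebra G" "\<And>x. norm (S x - S' x) \<le> e / 2 * norm x"
      and T': "T' \<in> op_algebra G" "\<And>x. norm (T x - T' x) \<le> e / 2 * norm x"
      using S T \<open>e > 0\<close> half_gt_zero unfolding uniform_closure_def by blast
    have "norm (S x + T x - (S' x + T' x)) \<le> e * norm x" for x
      using norm_triangle_ineq [of "S x - S' x" "T x - T' x"] S'(2) [of x] T'(2) [of x]
      by (simp add: add_diff_add)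
    then show ?thesis
      by (intro bexI [OF _ op_algebra.add [OF S'(1) T'(1)]]) blast
  qed
  then show ?thesis
    using S T by (auto simp: uniform_closure_def bounded_ops_def bounded_clinear_plus)
qed

lemma uniform_closure_mult:
  assumes S: "S \<in> uniform_closure (op_algebra G)" and T: "T \<in> uniform_closure (op_algebra G)"
  shows "S \<circ> T \<in> uniform_closure (op_algebra G)"
proof -
  have bS: "bounded_clinear S" and bT: "bounded_clinear T"
    using S T by (auto simp: uniform_closure_def bounded_ops_def)
  obtain K where K: "K > 0" "\<And>x. norm (T x) \<le> K * norm x"
    using bounded_clinear_bound [OF bT] by blast
  have "\<exists>A\<in>op_algebra G. \<forall>x. norm ((S \<circ> T) x - A x) \<le> e * norm x" if "e > 0" for e
  proof -
    have "e / (2 * K) > 0"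
      using \<open>e > 0\<close> K by simp
    then obtain S' where S': "S' \<in> op_algebra G" "\<And>x. norm (S x - S' x) \<le> e / (2 * K) * norm x"
      using S unfolding uniform_closure_def by blast
    have bS': "bounded_clinear S'"
      using S'(1) op_algebra_bounded [OF G] by (auto simp: bounded_ops_def)
    obtain L where L: "L > 0" "\<And>x. norm (S' x) \<le> L * norm x"
      using bounded_clinear_bound [OF bS'] by blast
    \<comment> \<open>The bound \<open>L\<close> belongs to the approximant \<open>S'\<close>, so
      \<open>S'\<close> has to be fixed before \<open>T'\<close>. The error is then split as
      \<open>(S - S') T + S' (T - T')\<close>.\<close>
    have "e / (2 * L) > 0"
      using \<open>e > 0\<close> L by simp
    then obtain T' where T': "T' \<in> op_algebra G" "\<And>x. norm (T x - T' x) \<le> e / (2 * L) * norm x"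
      using T unfolding uniform_closure_def by blast
    have "norm (S (T x) - S' (T' x)) \<le> e * norm x" for x
    proof -
      have "norm (S (T x) - S' (T x)) \<le> e / (2 * K) * (K * norm x)"
        using K \<open>e > 0\<close> by (intro order_trans [OF S'(2)] mult_left_mono) auto
      moreover have "norm (S' (T x - T' x)) \<le> L * (e / (2 * L) * norm x)"
        using L by (intro order_trans [OF L(2)] mult_left_mono T'(2)) auto
      moreover have eq: "S (T x) - S' (T' x) = (S (T x) - S' (T x)) + S' (T x - T' x)"
        by (simp add: bounded_clinear_simps [OF bS'])
      ultimately show ?thesis
        using norm_triangle_ineq [of "S (T x) - S' (T x)" "S' (T x - T' x)"] K L
        unfolding eq by (simp del: diff_add_eq add_diff_eq)
    qed
    then show ?thesis
      using op_algebra.mult [OF S'(1) T'(1)] by (intro bexI [of _ "S' \<circ> T'"]) auto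
  qed
  then show ?thesis
    using bounded_clinear_compose [OF bS bT] by (auto simp: uniform_closure_def bounded_ops_def)
qed

lemma uniform_closure_scale:
  assumes T: "T \<in> uniform_closure (op_algebra G)"
  shows "(\<lambda>x. c *\<^sub>C T x) \<in> uniform_closure (op_algebra G)"
proof -
  have "\<exists>A\<in>op_algebra G. \<forall>x. norm (c *\<^sub>C T x - A x) \<le> e * norm x" if "e > 0" for e
  proof -
    \<comment> \<open>The summand 1 covers \<open>c = 0\<close>.\<close>
    have "e / (norm c + 1) > 0"
      using \<open>e > 0\<close> by (simp add: add_nonneg_pos)
    then obtain T' where T': "T' \<in> op_algebra G" "\<And>x. norm (T x - T' x) \<le> e / (norm c + 1) * norm x"
      using T unfolding uniform_closure_def by blast
    have "norm (c *\<^sub>C T x - c *\<^sub>C T' x) \<le> e * norm x" for x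
    proof -
      have "norm (c *\<^sub>C T x - c *\<^sub>C T' x) = norm c * norm (T x - T' x)"
        by (simp flip: cvec.scale_right_diff_distrib)
      also have "\<dots> \<le> (norm c + 1) * (e / (norm c + 1) * norm x)"
        by (intro mult_mono T'(2)) auto
      also have "\<dots> = e * norm x"
        by (simp add: add_nonneg_eq_0_iff)
      finally show ?thesis .
    qed
    then show ?thesis
      by (intro bexI [OF _ op_algebra.scale [OF T'(1), of c]]) blast
  qed
  then show ?thesis
    using T by (auto simp: uniform_closure_def bounded_ops_def bounded_clinear_scale)
qed

lemma uniform_closure_diff:
  assumes "S \<in> uniform_closure (op_algebra G)" "T \<in> uniform_closure (op_algebra G)"
  shows "(\<lambda>x. S x - T x) \<in> uniform_closure (op_algebra G)"
  using uniform_closure_add [OF assms(1) uniform_closure_scale [OF assms(2), of "-1"]]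
  by (simp add: scaleC_simps)

lemma uniform_closure_sum:
  "(\<And>i. i \<in> F \<Longrightarrow> T i \<in> uniform_closure (op_algebra G)) \<Longrightarrow>
    (\<lambda>x. \<Sum>i\<in>F. T i x) \<in> uniform_closure (op_algebra G)"
  by (induction F rule: infinite_finite_induct) (simp_all add: uniform_closure_zero uniform_closure_add)

lemma uniform_closure_funpow:
  "T \<in> uniform_closure (op_algebra G) \<Longrightarrow> T ^^ Suc n \<in> uniform_closure (op_algebra G)"
  by (induction n) (simp_all add: uniform_closure_mult)

lemma uniform_closure_limit:
  assumes T: "T \<in> bounded_ops"
    and S: "\<And>e. e > 0 \<Longrightarrow> \<exists>S\<in>uniform_closure (op_algebra G). \<forall>x. norm (T x - S x) \<le> e * norm x"
  shows "T \<in> uniform_closure (op_algebra G)"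
proof -
  have "\<exists>A\<in>op_algebra G. \<forall>x. norm (T x - A x) \<le> e * norm x" if "e > 0" for e
  proof -
    obtain S where S: "S \<in> uniform_closure (op_algebra G)" "\<And>x. norm (T x - S x) \<le> e / 2 * norm x"
      using S [of "e / 2"] \<open>e > 0\<close> by auto
    then obtain A where A: "A \<in> op_algebra G" "\<And>x. norm (S x - A x) \<le> e / 2 * norm x"
      using \<open>e > 0\<close> half_gt_zero unfolding uniform_closure_def by blast
    have "norm (T x - A x) \<le> e * norm x" for x
      using norm_triangle_ineq [of "T x - S x" "S x - A x"] S(2) [of x] A(2) [of x] by simp
    then show ?thesis
      using A(1) by blast
  qed
  then show ?thesis
    using T by (simp add: uniform_closure_def)
qed

end

text \<open>The compressions of an operator to finitely many basis vectors are combinations of matrix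
  units and converge weakly to the operator.\<close>

lemma weak_op_dense_if_matrix_units:
  fixes e :: "'i \<Rightarrow> 'a::complex_hilbert"
  assumes G: "G \<subseteq> bounded_ops" and e: "orthonormal_basis UNIV e"
    and units: "\<And>k l. rank_one (e k) (e l) \<in> uniform_closure (op_algebra G)"
  shows "weak_op_topology closure_of (op_algebra G) = bounded_ops"
proof
  show "weak_op_topology closure_of (op_algebra G) \<subseteq> bounded_ops"
    by (metis closure_of_subset_topspace topspace_weak_op_topology)
  show "bounded_ops \<subseteq> weak_op_topology closure_of (op_algebra G)"
  proof
    fix T :: "'a \<Rightarrow> 'a" assume T: "T \<in> bounded_ops"
    then have bT: "bounded_clinear T"
      by (simp add: bounded_ops_def)
    define A where "A F x = (\<Sum>k\<in>F. \<Sum>l\<in>F. cinner (T (e l)) (e k) *\<^sub>C rank_one (e k) (e l) x)"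
      for F x
    define t where "t F x = (\<Sum>i\<in>F. cinner x (e i) *\<^sub>C e i)" for F x
    \<comment> \<open>The truncation \<open>t F\<close> is self-adjoint and \<open>A F\<close> is
      \<open>T\<close> truncated on both sides. So weak convergence reduces to convergence of
      \<open>t F\<close> in each argument.\<close>
    have A_eq: "cinner (A F x) y = cinner (T (t F x)) (t F y)" for F x y
    proof -
      have "cinner (T (t F x)) (t F y)
          = (\<Sum>k\<in>F. \<Sum>l\<in>F. cnj (cinner y (e k)) * (cinner x (e l) * cinner (T (e l)) (e k)))"
        unfolding t_def bounded_clinear_sum [OF bT] bounded_clinear_scaleC [OF bT] cinner_sum_left
          cinner_sum_right cinner_simps sum_distrib_left ..
      also have "\<dots> = cinner (A F x) y"
        unfolding A_def rank_one_def cinner_sum_left cinner_simps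
        by (simp only: cinner_commute [of "e k" y for k] mult_ac)
      finally show ?thesis ..
    qed
    have t: "((\<lambda>F. t F x) \<longlongrightarrow> x) (finite_subsets_at_top UNIV)" for x
      using fourier_expansion [OF e, of x] by (simp add: has_sum_def t_def)
    have Tt: "((\<lambda>F. T (t F x)) \<longlongrightarrow> T x) (finite_subsets_at_top UNIV)" for x
      using bounded_linear.tendsto [OF _ t, of T] bT by (simp add: bounded_clinear_def)
    have "T \<in> weak_op_topology closure_of uniform_closure (op_algebra G)"
    proof (rule weak_op_closureI [OF _ T finite_subsets_at_top_neq_bot])
      show "A F \<in> uniform_closure (op_algebra G)" for F
        unfolding A_def
        by (intro uniform_closure_sum [OF G] uniform_closure_scale [OF G] units)
      show "((\<lambda>F. cinner (A F x) y) \<longlongrightarrow> cinner (T x) y) (finite_subsets_at_top UNIV)" for x y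
        unfolding A_eq by (intro tendsto_cinner t Tt)
    qed (auto simp: uniform_closure_def)
    also have "\<dots> \<subseteq> weak_op_topology closure_of (weak_op_topology closure_of (op_algebra G))"
      by (intro closure_of_mono uniform_closure_subset_weak_closure op_algebra_bounded G)
    finally show "T \<in> weak_op_topology closure_of (op_algebra G)"
      by simp
  qed
qed


section \<open>Finite-dimensional invariant subspaces obstruct density\<close>

lemma bounded_clinear_span:
  assumes T: "bounded_clinear T" and x: "x \<in> cvec.span R"
    and R: "\<And>r. r \<in> R \<Longrightarrow> T r \<in> cvec.span F"
  shows "T x \<in> cvec.span F"
proof (rule cvec.span_induct [OF x, of "\<lambda>x. T x \<in> cvec.span F"])
  show "cvec.subspace {x. T x \<in> cvec.span F}"
    unfolding cvec.subspace_def
    by (auto simp: bounded_clinear_simps [OF T] cvec.span_add cvec.span_scale cvec.span_zero)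
qed (use R in auto)

text \<open>One further orthogonality condition lowers the dimension by at most one: a vector
  \<open>s\<close> violating the new condition, added to a finite spanning set for the smaller
  space, spans the larger one.\<close>

lemma infinite_cdim_orthogonal_complement:
  assumes inf: "infinite_cdim (UNIV :: 'a::complex_inner set)" and "finite F"
  shows "infinite_cdim {x :: 'a. \<forall>f\<in>F. cinner x f = 0}"
  using \<open>finite F\<close>
proof (induction F)
  case empty
  then show ?case
    using inf by simp
next
  case (insert f F)
  let ?K = "\<lambda>F. {x :: 'a. \<forall>f\<in>F. cinner x f = 0}"
  show ?case
    unfolding infinite_cdim_def
  proof
    assume "\<exists>B. finite B \<and> ?K (insert f F) \<subseteq> cvec.span B"
    then obtain B where B: "finite B" "?K (insert f F) \<subseteq> cvec.span B" by blast
    then obtain s where s: "s \<in> ?K F" "cinner s f \<noteq> 0"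
      using insert.IH unfolding infinite_cdim_def by blast
    have "?K F \<subseteq> cvec.span (insert s B)"
    proof
      fix x assume x: "x \<in> ?K F"
      define c where "c = cinner x f / cinner s f"
      have "x - c *\<^sub>C s \<in> ?K (insert f F)"
        using x s by (simp add: cinner_simps c_def)
      then have "x - c *\<^sub>C s \<in> cvec.span (insert s B)"
        using B cvec.span_mono [of B "insert s B"] by blast
      moreover have "c *\<^sub>C s \<in> cvec.span (insert s B)"
        by (intro cvec.span_scale cvec.span_base) simp
      ultimately have "(x - c *\<^sub>C s) + c *\<^sub>C s \<in> cvec.span (insert s B)"
        by (rule cvec.span_add)
      then show "x \<in> cvec.span (insert s B)"
        by simp
    qed
    then show False
      using insert.IH B(1) unfolding infinite_cdim_def by blast
  qed
qed

text \<open>The separating functional is \<open>\<lambda>T. cinner (T x0) y\<close> with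
  \<open>y\<close> orthogonal to \<open>F\<close>. It vanishes on the whole algebra but not at
  \<open>rank_one y x0\<close>, so a single subbasic open set excludes that operator from the
  closure.\<close>

lemma not_dense_if_finite_invariant:
  fixes G :: "('a::complex_inner \<Rightarrow> 'a) set"
  assumes inf: "infinite_cdim (UNIV :: 'a set)" and G: "G \<subseteq> bounded_ops" and "finite F"
    and x0: "x0 \<in> cvec.span F" "x0 \<noteq> 0"
    and inv: "\<And>T r. T \<in> G \<Longrightarrow> r \<in> F \<Longrightarrow> T r \<in> cvec.span F"
  shows "weak_op_topology closure_of (op_algebra G) \<noteq> bounded_ops"
proof
  assume dense: "weak_op_topology closure_of (op_algebra G) = bounded_ops"
  obtain y where y: "\<forall>f\<in>F. cinner y f = 0" "y \<noteq> 0"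
    using infinite_cdim_orthogonal_complement [OF inf \<open>finite F\<close>] cvec.span_zero
    unfolding infinite_cdim_def by (metis (mono_tags, lifting) finite.emptyI mem_Collect_eq subsetI)
  have perp: "cinner x y = 0" if "x \<in> cvec.span F" for x
    using that
  proof (rule cvec.span_induct [where P = "\<lambda>x. cinner x y = 0"])
    show "cvec.subspace {x. cinner x y = 0}"
      by (auto simp: cvec.subspace_def cinner_simps)
  qed (use y cinner_eq_0_commute in blast)
  have alg: "A x \<in> cvec.span F" if "A \<in> op_algebra G" "x \<in> cvec.span F" for A x
    using that
  proof (induction arbitrary: x)
    case (gen T)
    then show ?case
      using G inv by (auto simp: bounded_ops_def intro: bounded_clinear_span)
  qed (auto simp: cvec.span_zero cvec.span_add cvec.span_scale)
  define N where "N = {T \<in> bounded_ops. cinner (T x0) y \<in> - {0}}"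
  have "openin weak_op_topology N"
    unfolding weak_op_topology_def
    by (rule topology_generated_by_Basis) (auto simp: N_def intro!: exI [of _ "- {0}"])
  moreover have "rank_one y x0 \<in> N"
    using x0(2) y(2)
    by (simp add: N_def bounded_ops_def bounded_clinear_rank_one rank_one_def cinner_simps)
  moreover have "rank_one y x0 \<in> weak_op_topology closure_of (op_algebra G)"
    using dense by (simp add: bounded_ops_def bounded_clinear_rank_one)
  ultimately obtain A where "A \<in> op_algebra G" "A \<in> N"
    by (auto simp: in_closure_of)
  then show False
    using perp [OF alg [OF _ x0(1)]] by (simp add: N_def)
qed


section \<open>Polynomials in an operator\<close>

text \<open>Horner's recursion, on which the later inductions over polynomials rest. The zero
  polynomial is separate because there \<open>pCons\<close> does not raise the degree.\<close>

lemma poly_op_pCons: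
  assumes T: "bounded_clinear T"
  shows "poly_op (pCons a p) T x = a *\<^sub>C x + T (poly_op p T x)"
proof (cases "p = 0")
  case True
  then show ?thesis
    by (simp add: poly_op_def bounded_clinear_simps [OF T] scaleC_simps)
next
  case False
  then have "poly_op (pCons a p) T x
      = (\<Sum>i\<le>Suc (degree p). coeff (pCons a p) i *\<^sub>C (T ^^ i) x)"
    by (simp add: poly_op_def)
  also have "\<dots> = a *\<^sub>C x + (\<Sum>i\<le>degree p. coeff p i *\<^sub>C T ((T ^^ i) x))"
    by (subst sum.atMost_Suc_shift) simp
  also have "(\<Sum>i\<le>degree p. coeff p i *\<^sub>C T ((T ^^ i) x)) = T (poly_op p T x)"
    by (simp add: poly_op_def bounded_clinear_sum [OF T] bounded_clinear_scaleC [OF T])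
  finally show ?thesis .
qed

lemma poly_op_0: "poly_op 0 T x = 0"
  by (simp add: poly_op_def scaleC_simps)

lemma poly_op_add:
  assumes T: "bounded_clinear T"
  shows "poly_op (p + q) T x = poly_op p T x + poly_op q T x"
proof (induction p arbitrary: q)
  case 0
  then show ?case
    by (simp add: poly_op_0)
next
  case (pCons a p)
  obtain b r where q: "q = pCons b r"
    by (rule pCons_cases)
  show ?case
    using pCons.IH [of r]
    by (simp add: q poly_op_pCons [OF T] bounded_clinear_add [OF T] scaleC_add_left)
qed

lemma poly_op_smult:
  assumes T: "bounded_clinear T"
  shows "poly_op (smult c p) T x = c *\<^sub>C poly_op p T x"
  by (induction p)
    (simp_all add: poly_op_0 poly_op_pCons [OF T] bounded_clinear_scaleC [OF T]
      scaleC_add_right scaleC_simps)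

lemma poly_op_mult:
  assumes T: "bounded_clinear T"
  shows "poly_op (p * q) T x = poly_op p T (poly_op q T x)"
  by (induction p)
    (simp_all add: poly_op_0 poly_op_pCons [OF T] poly_op_add [OF T] poly_op_smult [OF T] scaleC_simps)

lemma poly_op_one: "poly_op 1 T x = x"
  by (simp add: poly_op_def scaleC_simps)

lemma poly_op_linear:
  assumes T: "bounded_clinear T"
  shows "poly_op [:- a, 1:] T x = T x - a *\<^sub>C x"
  by (simp add: poly_op_pCons [OF T] poly_op_0 bounded_clinear_zero [OF T] scaleC_simps)

lemma poly_op_linear_factor:
  assumes T: "bounded_clinear T"
  shows "poly_op ([:- a, 1:] * p) T x = T (poly_op p T x) - a *\<^sub>C poly_op p T x"
  by (simp only: poly_op_mult [OF T] poly_op_linear [OF T])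

lemma bounded_clinear_poly_op:
  assumes T: "bounded_clinear T"
  shows "bounded_clinear (poly_op p T)"
proof (induction p)
  case 0
  then show ?case
    by (simp add: poly_op_0 [abs_def] bounded_clinear_const_zero)
next
  case (pCons a p)
  have "poly_op (pCons a p) T = (\<lambda>x. a *\<^sub>C x + (T \<circ> poly_op p T) x)"
    by (simp add: poly_op_pCons [OF T] fun_eq_iff)
  then show ?case
    by (simp only: bounded_clinear_plus bounded_clinear_scale bounded_clinear_ident
        bounded_clinear_compose T pCons.IH)
qed

lemma poly_op_eigenvector:
  assumes T: "bounded_clinear T" and x: "T x = a *\<^sub>C x"
  shows "poly_op q T x = poly q a *\<^sub>C x"
  by (induction q)
    (simp_all add: poly_op_0 poly_op_pCons [OF T] bounded_clinear_scaleC [OF T] x scaleC_simps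
      scaleC_add_left mult.commute)

text \<open>Carries an annihilating polynomial over to the members of the unitary orbit.\<close>

lemma poly_op_conjugate:
  assumes T: "bounded_clinear T" and S: "bounded_clinear S" and W: "\<And>x. W (S x) = x" "\<And>x. S (W x) = x"
    and bW: "bounded_clinear W"
  shows "poly_op p (S \<circ> T \<circ> W) x = S (poly_op p T (W x))"
proof -
  have b: "bounded_clinear (S \<circ> T \<circ> W)"
    by (intro bounded_clinear_compose S T bW)
  show ?thesis
    by (induction p)
      (simp_all add: poly_op_0 poly_op_pCons [OF b, unfolded o_def]
        poly_op_pCons [OF T] bounded_clinear_simps [OF S] W o_def)
qed

section \<open>Minimal polynomials and eigenspaces of unitary operators\<close>

text \<open>The second hypothesis says that no root is double. It passes to the cofactor of a linear
  factor, and it keeps the root just split off out of the remaining root set, so that the product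
  can run over a set.\<close>

lemma monic_squarefree_splits:
  fixes p :: "complex poly"
  assumes "lead_coeff p = 1" and "\<And>a r. p = [:- a, 1:] * r \<Longrightarrow> poly r a \<noteq> 0"
  shows "\<exists>A. finite A \<and> card A = degree p \<and> p = (\<Prod>a\<in>A. [:- a, 1:])"
  using assms
proof (induction "degree p" arbitrary: p)
  case 0
  then have "p = 1"
    by (metis degree_0_id one_pCons)
  then show ?case
    by (intro exI [of _ "{}"]) simp
next
  case (Suc n)
  obtain a where "poly p a = 0"
    using Suc(2) fundamental_theorem_of_algebra [of p] constant_degree by (metis nat.distinct(1))
  then obtain r where r: "p = [:- a, 1:] * r"
    by (metis poly_eq_0_iff_dvd dvdE)
  then have lc: "lead_coeff r = 1"
    using Suc(3) lead_coeff_mult [of "[:- a, 1:]" r] by simp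
  then have "r \<noteq> 0"
    by auto
  then have "degree p = Suc (degree r)"
    unfolding r by (subst degree_mult_eq) auto
  then have deg: "degree r = n"
    using Suc(2) by simp
  have "poly s b \<noteq> 0" if "r = [:- b, 1:] * s" for b s
  proof -
    have "p = [:- b, 1:] * ([:- a, 1:] * s)"
      unfolding r that by (rule mult.left_commute)
    then have "poly ([:- a, 1:] * s) b \<noteq> 0"
      by (rule Suc(4))
    then show ?thesis
      by simp
  qed
  then obtain B where B: "finite B" "card B = n" "r = (\<Prod>a\<in>B. [:- a, 1:])"
    using Suc(1) [OF deg [symmetric] lc] deg by blast
  have "a \<notin> B"
    using Suc(4) [OF r] B(1) unfolding B(3) by (auto simp: poly_prod)
  then have "p = (\<Prod>a\<in>insert a B. [:- a, 1:])" "card (insert a B) = degree p"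
    using B r Suc(2) by simp_all
  then show ?case
    using B(1) by blast
qed

text \<open>The operator \<open>T - a\<close> is normal and hence has the same kernel as its square.\<close>

lemma unitary_minimal_poly_squarefree:
  fixes T :: "'a::complex_hilbert \<Rightarrow> 'a"
  assumes T: "unitary_op T" and p: "is_minimal_poly p T" and eq: "p = [:- a, 1:] * r"
  shows "poly r a \<noteq> 0"
proof
  have bT: "bounded_clinear T"
    using T by (simp add: unitary_op_def)
  assume "poly r a = 0"
  then obtain s where s: "r = [:- a, 1:] * s"
    by (metis poly_eq_0_iff_dvd dvdE)
  define N where "N x = T x - a *\<^sub>C x" for x
  define N' where "N' x = cadjoint T x - cnj a *\<^sub>C x" for x
  have bN': "bounded_clinear N'"
    unfolding N'_def
    by (intro bounded_clinear_sub bounded_clinear_cadjoint bounded_clinear_scale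
        bounded_clinear_ident bT)
  have TT: "cadjoint T (T x) = x" "T (cadjoint T x) = x" for x
    using T by (metis unitary_op_def comp_apply id_apply)+
  have adj: "cinner (N x) y = cinner x (N' y)" for x y
  proof -
    have "cinner (T x) y = cinner x (cadjoint T y)"
      by (metis cinner_cadjoint [OF bT] cinner_commute)
    then show ?thesis
      by (simp add: N_def N'_def cinner_simps)
  qed
  have comm: "N (N' x) = N' (N x)" for x
    by (simp add: N_def N'_def bounded_clinear_simps [OF bT] TT
        bounded_clinear_simps [OF bounded_clinear_cadjoint [OF bT]]
        cvec.scale_right_diff_distrib scaleC_scaleC mult.commute)
  have ker: "N x = 0" if "N (N x) = 0" for x
  proof -
    have "cinner (N' (N x)) (N' (N x)) = cinner (N (N' (N x))) (N x)"
      by (simp add: adj)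
    also have "\<dots> = 0"
      by (simp add: comm that bounded_clinear_zero [OF bN'])
    finally have "N' (N x) = 0"
      by simp
    then have "cinner (N x) (N x) = 0"
      by (simp add: adj)
    then show ?thesis
      by simp
  qed
  have "poly_op r T = (\<lambda>x. 0)"
  proof
    fix x
    have "poly_op p T x = 0"
      using p by (simp add: is_minimal_poly_def)
    then have "N (N (poly_op s T x)) = 0"
      unfolding eq s poly_op_linear_factor [OF bT] N_def .
    then have "N (poly_op s T x) = 0"
      by (rule ker)
    then show "poly_op r T x = 0"
      unfolding s poly_op_linear_factor [OF bT] N_def .
  qed
  moreover have "p \<noteq> 0"
    using p by (auto simp: is_minimal_poly_def)
  then have "r \<noteq> 0"
    using eq by auto
  then have "degree r < degree p"
    unfolding eq by (subst degree_mult_eq) auto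
  ultimately show False
    using p \<open>r \<noteq> 0\<close> unfolding is_minimal_poly_def by (metis not_le)
qed

text \<open>If \<open>a\<close> is a root with cofactor \<open>r\<close>, minimality makes
  \<open>poly_op r T\<close> nonzero, and each of its nonzero values is an eigenvector for
  \<open>a\<close>.\<close>

lemma minimal_poly_eigenvalue_iff:
  fixes T :: "'a::complex_hilbert \<Rightarrow> 'a"
  assumes T: "bounded_clinear T" and p: "is_minimal_poly p T"
  shows "op_eigenvalue T a \<longleftrightarrow> poly p a = 0"
proof
  assume "poly p a = 0"
  then obtain r where r: "p = [:- a, 1:] * r"
    by (metis poly_eq_0_iff_dvd dvdE)
  have "p \<noteq> 0"
    using p by (auto simp: is_minimal_poly_def)
  then have "r \<noteq> 0"
    using r by auto
  moreover from this have "degree r < degree p"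
    unfolding r by (subst degree_mult_eq) auto
  ultimately obtain x where "poly_op r T x \<noteq> 0"
    using p unfolding is_minimal_poly_def by (metis not_le)
  moreover have "T (poly_op r T x) - a *\<^sub>C poly_op r T x = 0"
    using p unfolding is_minimal_poly_def r poly_op_linear_factor [OF T, symmetric] by metis
  ultimately show "op_eigenvalue T a"
    unfolding op_eigenvalue_def by auto
next
  assume "op_eigenvalue T a"
  then obtain x where x: "x \<noteq> 0" "T x = a *\<^sub>C x"
    by (auto simp: op_eigenvalue_def)
  have "poly p a *\<^sub>C x = 0"
    using p poly_op_eigenvector [OF T x(2)] unfolding is_minimal_poly_def by metis
  then show "poly p a = 0"
    using x by simp
qed

text \<open>Applying \<open>T\<close> on both sides multiplies the inner product by
  \<open>a * cnj b\<close>. As \<open>b\<close> has modulus 1, this factor is 1 only for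
  \<open>a = b\<close>.\<close>

lemma unitary_eigenspaces_orthogonal:
  fixes T :: "'a::complex_hilbert \<Rightarrow> 'a"
  assumes T: "unitary_op T" and x: "T x = a *\<^sub>C x" and y: "T y = b *\<^sub>C y" and "a \<noteq> b"
  shows "cinner x y = 0"
proof (cases "y = 0")
  case False
  have "norm b = 1"
    using unitary_norm [OF T, of y] y False by simp
  then have "b * cnj b = 1"
    by (simp add: complex_norm_square [symmetric])
  then have "a * cnj b \<noteq> 1"
    using \<open>a \<noteq> b\<close> by (metis mult.commute mult.left_commute mult.right_neutral)
  moreover have "(a * cnj b) * cinner x y = cinner x y"
    using unitary_cinner [OF T, of x y] by (simp add: x y cinner_simps ac_simps)
  ultimately show ?thesis
    by (metis mult_cancel_right1)
qed simp

lemma subspace_op_eigenspace: "bounded_clinear T \<Longrightarrow> cvec.subspace (op_eigenspace T a)"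
  by (auto simp: cvec.subspace_def op_eigenspace_def bounded_clinear_simps scaleC_add_right
      scaleC_scaleC mult.commute)

text \<open>The invariant subspace is spanned by the vectors \<open>(B ^^ i) r\<close> with \<open>r \<in> R\<close> and
  \<open>i < degree q\<close>.\<close>

lemma not_dense_if_finite_rank_perturbation:
  fixes A B :: "'a::complex_hilbert \<Rightarrow> 'a"
  assumes inf: "infinite_cdim (UNIV :: 'a set)"
    and A: "bounded_clinear A" and B: "bounded_clinear B"
    and R: "finite R" "\<And>x. A x - a *\<^sub>C x \<in> cvec.span R" and x0: "x0 \<in> cvec.span R" "x0 \<noteq> 0"
    and q: "lead_coeff q = 1" "degree q > 0" "poly_op q B = (\<lambda>x. 0)"
  shows "weak_op_topology closure_of (op_algebra {A, B}) \<noteq> bounded_ops"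
proof -
  define F where "F = (\<Union>i<degree q. (B ^^ i) ` R)"
  have RF: "R \<subseteq> F"
    using q(2) by (auto simp: F_def intro!: bexI [of _ 0])
  then have span_RF: "cvec.span R \<subseteq> cvec.span F"
    by (rule cvec.span_mono)
  have base: "(B ^^ i) r \<in> cvec.span F" if "i < degree q" "r \<in> R" for i r
    using that by (auto simp: F_def intro!: cvec.span_base)
  have invA: "A x \<in> cvec.span F" if "x \<in> F" for x
  proof -
    have "(A x - a *\<^sub>C x) + a *\<^sub>C x \<in> cvec.span F"
      by (rule cvec.span_add [OF subsetD [OF span_RF R(2)]
            cvec.span_scale [OF cvec.span_base [OF that]]])
    then show ?thesis
      by simp
  qed
  have invB: "B x \<in> cvec.span F" if x: "x \<in> F" for x
  proof -
    obtain i r where i: "i < degree q" "r \<in> R" "x = (B ^^ i) r"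
      using x unfolding F_def by blast
    show ?thesis
    proof (cases "Suc i = degree q")
      case False
      then show ?thesis
        using i base [of "Suc i" r] by simp
    next
      \<comment> \<open>The top power leaves the generating list, but \<open>q\<close> is monic and
        annihilates \<open>B\<close>, so this power is a combination of the lower ones.\<close>
      case True
      have "poly_op q B r = (\<Sum>j<degree q. coeff q j *\<^sub>C (B ^^ j) r) + (B ^^ degree q) r"
        using q(1) by (simp add: poly_op_def lessThan_Suc_atMost [symmetric] scaleC_simps)
      moreover have "(B ^^ degree q) r = B x"
        by (simp add: i(3) flip: True)
      moreover have "poly_op q B r = 0"
        by (simp add: q(3))
      ultimately have "B x + (\<Sum>j<degree q. coeff q j *\<^sub>C (B ^^ j) r) = 0"
        by (metis add.commute)
      then have "B x = - (\<Sum>j<degree q. coeff q j *\<^sub>C (B ^^ j) r)"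
        by (simp only: eq_neg_iff_add_eq_0)
      also have "\<dots> \<in> cvec.span F"
        using i(2) by (intro cvec.span_neg cvec.span_sum cvec.span_scale base) auto
      finally show ?thesis .
    qed
  qed
  show ?thesis
  proof (rule not_dense_if_finite_invariant [OF inf, of _ F x0])
    show "finite F"
      using R(1) by (simp add: F_def)
  qed (use A B invA invB x0 span_RF in \<open>auto simp: bounded_ops_def\<close>)
qed


lemma unitary_minimal_poly_splits:
  fixes T :: "'a::complex_hilbert \<Rightarrow> 'a"
  assumes T: "unitary_op T" and p: "is_minimal_poly p T"
  obtains A where "finite A" "card A = degree p" "p = (\<Prod>a\<in>A. [:- a, 1:])"
    "\<And>a. op_eigenvalue T a \<longleftrightarrow> a \<in> A"
proof -
  have "lead_coeff p = 1"
    using p by (simp add: is_minimal_poly_def)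
  then obtain A where A: "finite A" "card A = degree p" "p = (\<Prod>a\<in>A. [:- a, 1:])"
    using monic_squarefree_splits unitary_minimal_poly_squarefree [OF T p] by metis
  have "bounded_clinear T"
    using T by (simp add: unitary_op_def)
  then have "op_eigenvalue T a \<longleftrightarrow> a \<in> A" for a
    using minimal_poly_eigenvalue_iff [OF _ p, of a] A(1) by (simp add: A(3) poly_prod)
  then show ?thesis
    using that A by blast
qed

text \<open>With \<open>q\<close> the product over the other roots, write \<open>q\<close> as the
  constant \<open>poly q b\<close> plus a multiple of the factor for \<open>b\<close>. At
  \<open>y\<close> this gives \<open>u = poly q b *\<^sub>C y + w\<close>, where \<open>u\<close> is
  in the eigenspace of \<open>b\<close> and \<open>q\<close> annihilates \<open>w\<close>. Since
  \<open>poly q b\<close> is nonzero, \<open>y\<close> is recovered from \<open>u\<close> and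
  \<open>w\<close>.\<close>

lemma kernel_subset_span_eigenspaces:
  assumes T: "bounded_clinear T" and "finite A"
    and R: "\<And>a. a \<in> A \<Longrightarrow> op_eigenspace T a \<subseteq> cvec.span R"
    and y: "poly_op (\<Prod>a\<in>A. [:- a, 1:]) T y = 0"
  shows "y \<in> cvec.span R"
  using \<open>finite A\<close> R y
proof (induction A arbitrary: y)
  case empty
  then show ?case
    by (simp add: poly_op_one cvec.span_zero)
next
  case (insert b A)
  define q where "q = (\<Prod>a\<in>A. [:- a, 1:])"
  have qb: "poly q b \<noteq> 0"
    using insert.hyps by (auto simp: q_def poly_prod)
  obtain s where s: "q - [:poly q b:] = [:- b, 1:] * s"
    by (metis poly_eq_0_iff_dvd dvdE poly_diff poly_pCons poly_0 add.right_neutral mult_zero_right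
        right_minus_eq)
  define u w where "u = poly_op q T y" and "w = poly_op ([:- b, 1:] * s) T y"
  have ker: "poly_op ([:- b, 1:] * q) T y = 0"
    using insert by (simp add: q_def)
  then have "u \<in> op_eigenspace T b"
    unfolding poly_op_linear_factor [OF T] by (simp add: u_def op_eigenspace_def)
  then have u: "u \<in> cvec.span R"
    using insert.prems(1) by blast
  have "q * ([:- b, 1:] * s) = s * ([:- b, 1:] * q)"
    by (simp only: ac_simps)
  then have "poly_op q T w = poly_op s T (poly_op ([:- b, 1:] * q) T y)"
    by (simp only: w_def poly_op_mult [OF T, symmetric])
  also have "\<dots> = 0"
    unfolding ker by (rule bounded_clinear_zero [OF bounded_clinear_poly_op [OF T]])
  finally have w: "w \<in> cvec.span R"
    using insert.IH insert.prems(1) by (simp add: q_def)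
  have "q = [:poly q b:] + [:- b, 1:] * s"
    using s by (metis add.commute diff_add_cancel)
  then have "u = poly_op [:poly q b:] T y + w"
    unfolding u_def w_def using poly_op_add [OF T] by metis
  then have "u = poly q b *\<^sub>C y + w"
    by (simp add: poly_op_pCons [OF T] poly_op_0 bounded_clinear_zero [OF T])
  then have "y = (1 / poly q b) *\<^sub>C (u - w)"
    using qb by (simp add: scaleC_simps)
  then show ?case
    using u w by (simp add: cvec.span_scale cvec.span_diff)
qed

text \<open>Serves both conditions, with \<open>U\<close> and \<open>V\<close> exchanging the roles
  of \<open>S\<close> and \<open>T\<close>. Outside \<open>a\<close> all eigenspaces are
  finite-dimensional, and \<open>T - a\<close> takes its values in their span. The eigenvalue
  \<open>b\<close> supplies a nonzero vector there.\<close>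

lemma not_dense_if_one_infinite_eigenspace:
  fixes S T :: "'a::complex_hilbert \<Rightarrow> 'a"
  assumes inf: "infinite_cdim (UNIV :: 'a set)" and S: "unitary_op S" and T: "unitary_op T"
    and q: "is_minimal_poly q S" "degree q > 0"
    and p: "poly_op (\<Prod>a\<in>A. [:- a, 1:]) T = (\<lambda>x. 0)" "finite A"
    and a: "a \<in> A" "\<And>b. b \<in> A - {a} \<Longrightarrow> \<not> infinite_cdim (op_eigenspace T b)"
    and b: "b \<in> A - {a}" "op_eigenvalue T b"
    and S0: "S0 \<in> unitary_orbit S" and T0: "T0 \<in> unitary_orbit T"
  shows "weak_op_topology closure_of (op_algebra {T0, S0}) \<noteq> bounded_ops"
proof -
  have bS: "bounded_clinear S" and bT: "bounded_clinear T"
    using S T by (auto simp: unitary_op_def)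
  obtain W where W: "unitary_op W" "S0 = cadjoint W \<circ> S \<circ> W"
    using S0 by (auto simp: unitary_orbit_def)
  obtain Y where Y: "unitary_op Y" "T0 = cadjoint Y \<circ> T \<circ> Y"
    using T0 by (auto simp: unitary_orbit_def)
  have bW: "bounded_clinear W" "bounded_clinear (cadjoint W)"
    and bY: "bounded_clinear Y" "bounded_clinear (cadjoint Y)"
    using W Y by (auto simp: unitary_op_def bounded_clinear_cadjoint)
  have WW: "W (cadjoint W x) = x" "cadjoint W (W x) = x" for x
    using W(1) by (metis unitary_op_def comp_apply id_apply)+
  have YY: "Y (cadjoint Y x) = x" "cadjoint Y (Y x) = x" for x
    using Y(1) by (metis unitary_op_def comp_apply id_apply)+
  have "\<forall>b\<in>A - {a}. \<exists>B. finite B \<and> op_eigenspace T b \<subseteq> cvec.span B"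
    using a(2) by (simp add: infinite_cdim_def)
  then obtain B where B: "\<And>b. b \<in> A - {a} \<Longrightarrow> finite (B b)"
      "\<And>b. b \<in> A - {a} \<Longrightarrow> op_eigenspace T b \<subseteq> cvec.span (B b)"
    by metis
  define R where "R = (\<Union>b\<in>A - {a}. B b)"
  have R: "op_eigenspace T b \<subseteq> cvec.span R" if "b \<in> A - {a}" for b
    using B(2) [OF that] cvec.span_mono [of "B b" R] that unfolding R_def by blast
  have TR: "T x - a *\<^sub>C x \<in> cvec.span R" for x
  proof (rule kernel_subset_span_eigenspaces [OF bT, of "A - {a}"])
    have "(\<Prod>b\<in>A. [:- b, 1:]) = (\<Prod>b\<in>A - {a}. [:- b, 1:]) * [:- a, 1:]"
      using p(2) a(1) by (simp add: prod.remove [of A a] mult.commute del: mult_pCons_right mult_pCons_left)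
    then show "poly_op (\<Prod>b\<in>A - {a}. [:- b, 1:]) T (T x - a *\<^sub>C x) = 0"
      using p(1) by (metis poly_op_linear [OF bT] poly_op_mult [OF bT])
  qed (use p(2) R in auto)
  have conj: "cadjoint Y x \<in> cvec.span (cadjoint Y ` R)" if "x \<in> cvec.span R" for x
    by (rule bounded_clinear_span [OF bY(2) that]) (auto intro: cvec.span_base)
  obtain x1 where x1: "x1 \<noteq> 0" "T x1 = b *\<^sub>C x1"
    using b(2) by (auto simp: op_eigenvalue_def)
  show ?thesis
  proof (rule not_dense_if_finite_rank_perturbation [OF inf])
    show "bounded_clinear T0" "bounded_clinear S0"
      unfolding W Y by (intro bounded_clinear_compose bS bT bW bY)+
    show "finite (cadjoint Y ` R)"
      using p(2) B(1) by (simp add: R_def)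
    have "T0 x - a *\<^sub>C x = cadjoint Y (T (Y x) - a *\<^sub>C Y x)" for x
      by (simp add: Y bounded_clinear_simps [OF bY(2)] YY)
    then show "T0 x - a *\<^sub>C x \<in> cvec.span (cadjoint Y ` R)" for x
      using conj TR by simp
    have "x1 \<in> cvec.span R"
      using R [OF b(1)] x1 by (auto simp: op_eigenspace_def)
    then show "cadjoint Y x1 \<in> cvec.span (cadjoint Y ` R)"
      by (rule conj)
    show "cadjoint Y x1 \<noteq> 0"
      using x1(1) YY(1) [of x1] bounded_clinear_zero [OF bY(1)] by auto
    show "lead_coeff q = 1" "degree q > 0"
      using q by (auto simp: is_minimal_poly_def)
    show "poly_op q S0 = (\<lambda>x. 0)"
      unfolding W using q(1)
      by (simp add: fun_eq_iff poly_op_conjugate [OF bS bW(2) WW bW(1)] is_minimal_poly_def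
          bounded_clinear_zero [OF bW(2)] del: o_apply)
  qed
qed


section \<open>Operators that are diagonal in an orthonormal basis\<close>

text \<open>Completeness: let \<open>x\<close> be orthogonal to all eigenspaces. Applying to it all
  factors but the one for \<open>a\<close> gives an eigenvector for \<open>a\<close> that is still
  orthogonal to that eigenspace, hence zero. So the factors can be removed one by one until
  \<open>x\<close> itself is zero.\<close>

lemma unitary_eigenbasis:
  fixes T :: "'a::complex_hilbert \<Rightarrow> 'a"
  assumes T: "unitary_op T" and "finite A" and p: "poly_op (\<Prod>a\<in>A. [:- a, 1:]) T = (\<lambda>x. 0)"
    and b: "\<And>a. a \<in> A \<Longrightarrow> orthonormal_basis_of (op_eigenspace T a) (J a) (b a)"
  shows "orthonormal_basis (Sigma A J) (\<lambda>(a, n). b a n)"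
proof -
  have bT: "bounded_clinear T"
    using T by (simp add: unitary_op_def)
  have eig: "T (b a n) = a *\<^sub>C b a n" if "a \<in> A" "n \<in> J a" for a n
    using b [OF that(1)] that(2) by (auto simp: orthonormal_basis_of_def op_eigenspace_def)
  have "orthonormal_on (Sigma A J) (\<lambda>(a, n). b a n)"
    unfolding orthonormal_on_def
  proof (intro ballI, clarify)
    fix a n a' n' assume *: "a \<in> A" "n \<in> J a" "a' \<in> A" "n' \<in> J a'"
    show "cinner (b a n) (b a' n') = (if (a, n) = (a', n') then 1 else 0)"
    proof (cases "a = a'")
      case True
      then show ?thesis
        using b [OF *(1)] * by (auto simp: orthonormal_basis_of_def orthonormal_on_def)
    next
      case False
      then show ?thesis
        using unitary_eigenspaces_orthogonal [OF T eig [OF *(1,2)] eig [OF *(3,4)]] by simp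
    qed
  qed
  moreover have "x = 0" if perp: "\<And>a n. a \<in> A \<Longrightarrow> n \<in> J a \<Longrightarrow> cinner x (b a n) = 0" for x
  proof -
    \<comment> \<open>An eigenvector of a unitary is also one of the adjoint, for the conjugate
      eigenvalue. Therefore polynomials in \<open>T\<close> preserve orthogonality to
      eigenvectors.\<close>
    have comp: "cinner (poly_op q T x) e = poly q a * cinner x e" if e: "T e = a *\<^sub>C e" for q a e x
    proof (cases "e = 0")
      case False
      have "norm a = 1"
        using unitary_norm [OF T, of e] e False by simp
      then have a: "a * cnj a = 1"
        by (simp add: complex_norm_square [symmetric])
      have Te: "cinner (T y) e = a * cinner y e" for y
      proof -
        have "cinner (T y) e = a * (cnj a * cinner (T y) e)"
          by (metis a mult.assoc mult_1)
        also have "cnj a * cinner (T y) e = cinner y e"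
          using unitary_cinner [OF T, of y e] by (simp add: e cinner_simps)
        finally show ?thesis .
      qed
      show ?thesis
        by (induction q) (simp_all add: poly_op_0 poly_op_pCons [OF bT] cinner_simps Te algebra_simps)
    qed simp
    have "poly_op (\<Prod>a\<in>B. [:- a, 1:]) T x = 0 \<Longrightarrow> B \<subseteq> A \<Longrightarrow> x = 0" if "finite B" for B
      using that
    proof (induction B)
      case (insert a B)
      define y where "y = poly_op (\<Prod>a\<in>B. [:- a, 1:]) T x"
      have "poly_op ([:- a, 1:] * (\<Prod>a\<in>B. [:- a, 1:])) T x = 0"
        using insert by (simp del: mult_pCons_left mult_pCons_right)
      then have "y \<in> op_eigenspace T a"
        unfolding poly_op_linear_factor [OF bT] by (simp add: y_def op_eigenspace_def)
      moreover have "cinner y (b a n) = 0" if "n \<in> J a" for n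
        using comp [OF eig] insert.prems perp that by (simp add: y_def)
      ultimately have "y = 0"
        using b [of a] insert.prems(2) by (auto simp: orthonormal_basis_of_def)
      then show ?case
        using insert by (simp add: y_def)
    qed (simp add: poly_op_one)
    then show ?thesis
      using p \<open>finite A\<close> by (metis subset_refl)
  qed
  ultimately show ?thesis
    by (auto simp: orthonormal_basis_def)
qed

lemma orthonormal_basis_reindex:
  assumes b: "orthonormal_basis I b" and f: "bij_betw f I' I"
  shows "orthonormal_basis I' (\<lambda>i. b (f i))"
proof -
  have "f ` I' = I" "inj_on f I'"
    using f by (auto simp: bij_betw_def)
  then show ?thesis
    using b unfolding orthonormal_basis_def orthonormal_on_def
    by (auto simp: inj_on_eq_iff)
qed

text \<open>The source of all orbit members: any orthonormal basis with the index set of an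
  eigenbasis becomes an eigenbasis of some conjugate, with the same eigenvalues.\<close>

lemma unitary_orbit_diagonal:
  fixes T :: "'a::complex_hilbert \<Rightarrow> 'a"
  assumes T: "unitary_op T" and b: "orthonormal_basis I b" and c: "orthonormal_basis I c"
    and Tc: "\<And>i. i \<in> I \<Longrightarrow> T (c i) = \<mu> i *\<^sub>C c i"
  obtains T0 where "T0 \<in> unitary_orbit T" "bounded_clinear T0"
    "\<And>i. i \<in> I \<Longrightarrow> T0 (b i) = \<mu> i *\<^sub>C b i"
proof -
  obtain W where W: "unitary_op W" "\<And>i. i \<in> I \<Longrightarrow> W (b i) = c i"
    by (rule unitary_between_bases [OF b c]) blast
  have bW: "bounded_clinear W" "bounded_clinear (cadjoint W)" "bounded_clinear T"
    using W T by (auto simp: unitary_op_def bounded_clinear_cadjoint)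
  have WW: "cadjoint W (W x) = x" for x
    using W(1) by (metis unitary_op_def comp_apply id_apply)
  show ?thesis
  proof
    show "cadjoint W \<circ> T \<circ> W \<in> unitary_orbit T"
      using W(1) by (auto simp: unitary_orbit_def)
    show "bounded_clinear (cadjoint W \<circ> T \<circ> W)"
      by (intro bounded_clinear_compose bW)
    show "(cadjoint W \<circ> T \<circ> W) (b i) = \<mu> i *\<^sub>C b i" if "i \<in> I" for i
      using W(2) [OF that] Tc [OF that] WW [of "b i"] by (simp add: bounded_clinear_scaleC [OF bW(2)])
  qed
qed

section \<open>Coordinates and norms of diagonal operators\<close>

context
  fixes I :: "'i set" and b :: "'i \<Rightarrow> 'a::complex_hilbert" and D :: "'a \<Rightarrow> 'a" and \<mu> :: "'i \<Rightarrow> complex"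
  assumes b: "orthonormal_basis I b" and D: "bounded_clinear D"
    and diag: "\<And>i. i \<in> I \<Longrightarrow> D (b i) = \<mu> i *\<^sub>C b i"
begin

lemma diagonal_coeff:
  assumes j: "j \<in> I"
  shows "cinner (D x) (b j) = \<mu> j * cinner x (b j)"
proof -
  have "bounded_linear D"
    using D by (simp add: bounded_clinear_def)
  from has_sum_bounded_linear [OF this fourier_expansion [OF b, of x]]
  have "((\<lambda>i. (\<mu> i * cinner x (b i)) *\<^sub>C b i) has_sum D x) I"
    by (rule has_sum_cong [THEN iffD1, rotated])
      (simp add: bounded_clinear_scaleC [OF D] diag scaleC_scaleC mult.commute)
  then show ?thesis
    by (rule cinner_has_sum_orthonormal [OF orthonormal_basis_orthonormal [OF b] _ j])
qed

lemma diagonal_symmetric: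
  assumes "\<And>i. i \<in> I \<Longrightarrow> \<mu> i \<in> \<real>"
  shows "cinner (D x) y = cinner x (D y)"
proof -
  have "((\<lambda>i. cinner (D x) (b i) * cnj (cinner y (b i))) has_sum cinner x (D y)) I"
    using parseval [OF b, of x "D y"]
    by (rule has_sum_cong [THEN iffD1, rotated])
      (use assms in \<open>simp add: diagonal_coeff Reals_cnj_iff\<close>)
  then show ?thesis
    using parseval [OF b, of "D x" y] has_sum_unique by blast
qed

lemma diagonal_norm_le:
  assumes r: "\<And>i. i \<in> I \<Longrightarrow> norm (\<mu> i) \<le> r" "r \<ge> 0"
  shows "norm (D x) \<le> r * norm x"
proof -
  have "((\<lambda>i. (norm (cinner (D x) (b i)))\<^sup>2) has_sum (norm (D x))\<^sup>2) I"
    by (rule parseval_norm [OF b])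
  moreover have "((\<lambda>i. r\<^sup>2 * (norm (cinner x (b i)))\<^sup>2) has_sum r\<^sup>2 * (norm x)\<^sup>2) I"
    by (intro has_sum_cmult_right parseval_norm [OF b])
  ultimately have "(norm (D x))\<^sup>2 \<le> r\<^sup>2 * (norm x)\<^sup>2"
    by (rule has_sum_mono)
      (simp add: diagonal_coeff norm_mult power_mult_distrib mult_right_mono power_mono r)
  then have "(norm (D x))\<^sup>2 \<le> (r * norm x)\<^sup>2"
    by (simp add: power_mult_distrib)
  then show ?thesis
    by (rule power2_le_imp_le) (use r in simp)
qed

end

text \<open>Evaluated at an operator with the finitely many distinct eigenvalues \<open>f i\<close>,
  such a polynomial is a spectral projection.\<close>

lemma lagrange_polynomial:
  assumes "finite A" "inj_on f A" "m \<in> A"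
  obtains p :: "complex poly" where "\<And>i. i \<in> A \<Longrightarrow> poly p (f i) = (if i = m then 1 else 0)"
proof
  fix i assume "i \<in> A"
  let ?p = "\<Prod>j\<in>A - {m}. smult (1 / (f m - f j)) [:- f j, 1:]"
  show "poly ?p (f i) = (if i = m then 1 else 0)"
  proof (cases "i = m")
    case True
    have "(\<Prod>j\<in>A - {m}. (f m - f j) / (f m - f j)) = 1"
      using assms by (intro prod.neutral) (auto simp: inj_on_def)
    then show ?thesis
      using True by (simp add: poly_prod flip: diff_divide_distrib)
  next
    case False
    then show ?thesis
      using \<open>i \<in> A\<close> \<open>finite A\<close> by (auto simp: poly_prod)
  qed
qed


section \<open>The two orthonormal bases\<close>

lemma coupling_vector:
  fixes e :: "bool \<times> nat \<Rightarrow> 'a::complex_hilbert"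
  assumes e: "orthonormal_basis UNIV e"
  obtains v where "norm v = 1" "\<And>n. cinner v (e (False, n)) = 0" "\<And>n. cinner v (e (True, n)) \<noteq> 0"
    "\<And>l. cinner v (e (True, 2 * l + 1)) = cinner v (e (True, 2 * l + 2))"
proof -
  \<comment> \<open>The weights are 1, 1/2, 1/2, 1/4, 1/4 and so on. Equal weights at
    \<open>2 * l + 1\<close> and \<open>2 * l + 2\<close> make the difference of these two basis
    vectors orthogonal to \<open>v\<close>; index 0 stays unpaired. Square summability follows since
    \<open>2 * (Suc n div 2)\<close> is at least \<open>n\<close>.\<close>
  define w :: "nat \<Rightarrow> real" where "w n = (1 / 2) ^ (Suc n div 2)" for n
  define a where "a k = (if fst k then complex_of_real (w (snd k)) else 0)" for k :: "bool \<times> nat"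
  have w_le: "(w n)\<^sup>2 \<le> (1 / 2) ^ n" for n
    unfolding w_def power_mult [symmetric] by (rule power_decreasing) auto
  have "summable (\<lambda>n. norm ((w n)\<^sup>2))"
    by (rule summable_comparison_test' [OF summable_geometric [of "1 / 2 :: real"], of 0])
      (use w_le in auto)
  then have "(\<lambda>n. (w n)\<^sup>2) summable_on UNIV"
    by (rule norm_summable_imp_summable_on)
  then have "(\<lambda>n. (norm (a (True, n)))\<^sup>2) summable_on UNIV"
    by (simp add: a_def)
  then have "((\<lambda>k. (norm (a k))\<^sup>2) \<circ> Pair True) summable_on UNIV"
    by (simp add: o_def)
  then have "(\<lambda>k. (norm (a k))\<^sup>2) summable_on range (Pair True)"
    by (subst summable_on_reindex) (auto intro: injI)
  then have "(\<lambda>k. (norm (a k))\<^sup>2) summable_on UNIV"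
    by (rule summable_on_cong_neutral [THEN iffD1, rotated -1]) (auto simp: a_def)
  then obtain y where y: "\<And>k. cinner y (e k) = a k"
    by (rule riesz_fischer [OF orthonormal_basis_orthonormal [OF e]]) auto
  have w_pos: "w n > 0" for n
    by (simp add: w_def)
  have "cinner y (e (True, 0)) \<noteq> 0"
    using w_pos [of 0] by (simp add: y a_def)
  then have "y \<noteq> 0"
    by auto
  define v where "v = complex_of_real (1 / norm y) *\<^sub>C y"
  have v: "cinner v (e k) = complex_of_real (1 / norm y) * a k" for k
    by (simp add: v_def cinner_simps y)
  show ?thesis
  proof
    show "norm v = 1"
      using \<open>y \<noteq> 0\<close> by (simp add: v_def norm_divide)
    show "cinner v (e (False, n)) = 0" for n
      by (simp add: v a_def)
    show "cinner v (e (True, n)) \<noteq> 0" for n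
      using \<open>y \<noteq> 0\<close> w_pos [of n] by (simp add: v a_def)
    show "cinner v (e (True, 2 * l + 1)) = cinner v (e (True, 2 * l + 2))" for l
      by (simp add: v a_def w_def)
  qed
qed

text \<open>The third block of the basis consists of a unit vector \<open>v\<close> that meets every \<open>e (True, n)\<close>,
  together with some of the vectors \<open>z l\<close>, which are orthogonal to \<open>v\<close> and to \<open>e (True, 0)\<close>. The
  remaining \<open>z l\<close> keep the second block infinite.\<close>

lemma coupling_basis:
  fixes e :: "bool \<times> nat \<Rightarrow> 'a::complex_hilbert" and J :: "nat set"
  assumes sep: "separable_space (euclidean :: 'a topology)" and e: "orthonormal_basis UNIV e"
    and J: "0 \<in> J"
  obtains c :: "nat \<times> nat \<Rightarrow> 'a" where
    "orthonormal_basis (Sigma {..<3} (\<lambda>k. if k = 2 then J else UNIV)) c"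
    "\<And>n. c (0, n) = e (False, n)"
    "\<And>n. cinner (c (2, 0)) (e (True, n)) \<noteq> 0"
    "\<And>n. Suc n \<in> J \<Longrightarrow> cinner (e (True, 0)) (c (2, Suc n)) = 0"
proof -
  obtain v where v: "norm v = 1" "\<And>n. cinner v (e (False, n)) = 0" "\<And>n. cinner v (e (True, n)) \<noteq> 0"
    "\<And>l. cinner v (e (True, 2 * l + 1)) = cinner v (e (True, 2 * l + 2))"
    by (rule coupling_vector [OF e]) blast
  have ee: "cinner (e k) (e l) = (if k = l then 1 else 0)" for k l
    using orthonormal_onD [OF orthonormal_basis_orthonormal [OF e]] by simp
  define \<kappa> where "\<kappa> = complex_of_real (1 / sqrt 2)"
  have "cnj \<kappa> * (2 * \<kappa>) = 2 * (\<kappa> * \<kappa>)"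
    by (simp add: \<kappa>_def)
  also have "\<kappa> * \<kappa> = 1 / 2"
    by (simp add: \<kappa>_def flip: of_real_mult)
  finally have \<kappa>: "cnj \<kappa> * (2 * \<kappa>) = 1"
    by simp
  define z where "z l = \<kappa> *\<^sub>C (e (True, 2 * l + 1) - e (True, 2 * l + 2))" for l
  have zz: "cinner (z l) (z m) = (if l = m then 1 else 0)" for l m
  proof -
    have "2 * l + 1 \<noteq> 2 * m + 2" "2 * l + 2 \<noteq> 2 * m + 1"
      by presburger+
    then show ?thesis
      by (simp add: z_def cinner_simps ee \<kappa>)
  qed
  have "cinner v (z l) = 0" for l
    using v(4) [of l] by (simp add: z_def cinner_simps)
  then have vz: "cinner v (z l) = 0" "cinner (z l) v = 0" for l
    using cinner_eq_0_commute by blast+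
  have gz: "cinner (e (False, n)) (z l) = 0" "cinner (z l) (e (False, n)) = 0" for n l
    by (simp_all add: z_def cinner_simps ee)
  have gv: "cinner (e (False, n)) v = 0" for n
    using v(2) cinner_eq_0_commute by blast
  have vv: "cinner v v = 1"
    using v(1) by (simp add: cinner_self)
  \<comment> \<open>The orthogonal complement of the first and third blocks, so any orthonormal
    basis of it completes the family. The third block takes only even-numbered \<open>z\<close>. The
    odd-numbered ones lie in \<open>M\<close> and make it infinite-dimensional, whatever
    \<open>J\<close> is.\<close>
  define M where "M = {x. (\<forall>n. cinner x (e (False, n)) = 0) \<and> cinner x v = 0 \<and>
    (\<forall>n. Suc n \<in> J \<longrightarrow> cinner x (z (2 * n)) = 0)}"
  have "cvec.subspace M"
    by (auto simp: cvec.subspace_def M_def cinner_simps)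
  moreover have "orthonormal_on UNIV (\<lambda>n. z (2 * n + 1))"
    by (simp add: orthonormal_on_def zz)
  moreover have "2 * l + 1 \<noteq> 2 * n" for l n :: nat
    by presburger
  then have "range (\<lambda>n. z (2 * n + 1)) \<subseteq> M"
    by (auto simp: M_def gz vz zz)
  ultimately obtain m :: "nat \<Rightarrow> 'a" where m: "orthonormal_basis_of M UNIV m"
    using infinite_orthonormal_basis_extending [OF sep] by blast
  then have mm: "cinner (m k) (m l) = (if k = l then 1 else 0)" for k l
    by (simp add: orthonormal_basis_of_def orthonormal_on_def)
  have "m k \<in> M" for k
    using m by (auto simp: orthonormal_basis_of_def)
  then have mM: "cinner (m k) (e (False, n)) = 0" "cinner (m k) v = 0"
      "Suc n \<in> J \<Longrightarrow> cinner (m k) (z (2 * n)) = 0" for k n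
    by (auto simp: M_def)
  then have mM': "cinner (e (False, n)) (m k) = 0" "cinner v (m k) = 0"
      "Suc n \<in> J \<Longrightarrow> cinner (z (2 * n)) (m k) = 0" for k n
    using cinner_eq_0_commute by blast+
  \<comment> \<open>The shift by one in the third block is due to \<open>v\<close> occupying index
    0.\<close>
  define c where "c = (\<lambda>(k, n). if k = 0 then e (False, n) else if k = (1::nat) then m n
    else if n = 0 then v else z (2 * (n - 1)))"
  let ?K = "\<lambda>k::nat. if k = 2 then J else UNIV"
  have "orthonormal_on (Sigma {..<3} ?K) c"
    unfolding orthonormal_on_def
  proof (intro ballI)
    fix i i' assume i: "i \<in> Sigma {..<3} ?K" "i' \<in> Sigma {..<3} ?K"
    obtain k n k' n' where kn: "i = (k, n)" "i' = (k', n')"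
      by (meson surj_pair)
    have "(k = 0 \<or> k = 1 \<or> k = 2) \<and> (k' = 0 \<or> k' = 1 \<or> k' = 2)"
      using i unfolding kn by auto
    then show "cinner (c i) (c i') = (if i = i' then 1 else 0)"
      using i unfolding kn
      by (cases n; cases n') (auto simp: c_def ee mm zz vv gz gv vz v(2) mM mM')
  qed
  moreover have "x = 0" if "\<forall>i\<in>Sigma {..<3} ?K. cinner x (c i) = 0" for x
  proof -
    have x: "cinner x (c (k, n)) = 0" if "k < 3" "k = 2 \<Longrightarrow> n \<in> J" for k n
      using that \<open>\<forall>i\<in>Sigma {..<3} ?K. cinner x (c i) = 0\<close> by auto
    have "cinner x (e (False, n)) = 0" for n
      using x [of 0 n] by (simp add: c_def)
    moreover have "cinner x v = 0"
      using x [of 2 0] J by (simp add: c_def)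
    moreover have "cinner x (z (2 * n)) = 0" if "Suc n \<in> J" for n
      using x [of 2 "Suc n"] that by (simp add: c_def)
    ultimately have "x \<in> M"
      by (simp add: M_def)
    moreover have "cinner x (m n) = 0" for n
      using x [of 1 n] by (simp add: c_def)
    ultimately show ?thesis
      using m by (auto simp: orthonormal_basis_of_def)
  qed
  ultimately have "orthonormal_basis (Sigma {..<3} ?K) c"
    by (simp add: orthonormal_basis_def)
  moreover have "cinner (e (True, 0)) (c (2, Suc n)) = 0" for n
    by (simp add: c_def z_def cinner_simps ee)
  ultimately show ?thesis
    using that [of c] v(3) by (simp add: c_def)
qed

text \<open>A rotation in each plane spanned by \<open>e (True, n)\<close> and
  \<open>e (False, n)\<close>, with sine \<open>s n\<close> and cosine \<open>t n\<close>.\<close>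

lemma rotated_basis:
  fixes e :: "bool \<times> nat \<Rightarrow> 'a::complex_hilbert" and s t :: "nat \<Rightarrow> real"
  assumes e: "orthonormal_basis UNIV e" and st: "\<And>n. (s n)\<^sup>2 + (t n)\<^sup>2 = 1"
  shows "orthonormal_basis UNIV (\<lambda>(k, n). if k
    then complex_of_real (t n) *\<^sub>C e (True, n) - complex_of_real (s n) *\<^sub>C e (False, n)
    else complex_of_real (s n) *\<^sub>C e (True, n) + complex_of_real (t n) *\<^sub>C e (False, n))"
    (is "orthonormal_basis UNIV ?c")
proof -
  have ee: "cinner (e k) (e l) = (if k = l then 1 else 0)" for k l
    using orthonormal_onD [OF orthonormal_basis_orthonormal [OF e]] by simp
  have st': "complex_of_real (s n) * complex_of_real (s n) + complex_of_real (t n) * complex_of_real (t n) = 1"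
    for n
    using arg_cong [OF st [of n], of complex_of_real] by (simp add: power2_eq_square)
  then have st'': "complex_of_real (t n) * complex_of_real (t n) + complex_of_real (s n) * complex_of_real (s n) = 1"
    for n
    by (simp add: add.commute)
  have "orthonormal_on UNIV ?c"
    unfolding orthonormal_on_def
  proof (intro ballI)
    fix i i'
    show "cinner (?c i) (?c i') = (if i = i' then 1 else 0)"
      by (cases i; cases i'; cases "fst i"; cases "fst i'") (simp_all add: cinner_simps ee st' st'')
  qed
  moreover have "x = 0" if "\<forall>i\<in>UNIV. cinner x (?c i) = 0" for x
  proof -
    have eqs: "complex_of_real (t n) * cinner x (e (True, n)) = complex_of_real (s n) * cinner x (e (False, n))"
      "complex_of_real (s n) * cinner x (e (True, n)) = - (complex_of_real (t n) * cinner x (e (False, n)))"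
      for n
      using that [rule_format, of "(True, n)"] that [rule_format, of "(False, n)"]
      by (simp_all add: cinner_simps eq_neg_iff_add_eq_0)
    have "cinner x (e (True, n)) = 0 \<and> cinner x (e (False, n)) = 0" for n
      using eqs [of n] st' [of n] by algebra
    then have "cinner x (e k) = 0" for k
      by (metis (full_types) surj_pair)
    then show "x = 0"
      by (intro orthonormal_basis_eqI [OF e]) simp
  qed
  ultimately show ?thesis
    by (simp add: orthonormal_basis_def)
qed


section \<open>Generating all matrix units\<close>

text \<open>The identity is a hypothesis because \<open>op_algebra\<close> adjoins no unit; it
  accounts for the constant terms.\<close>

lemma uniform_closure_poly_op:
  assumes G: "G \<subseteq> bounded_ops" and T: "bounded_clinear T" "T \<in> uniform_closure (op_algebra G)"
    and one: "(\<lambda>x. x) \<in> uniform_closure (op_algebra G)"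
  shows "poly_op p T \<in> uniform_closure (op_algebra G)"
proof (induction p)
  case 0
  then show ?case
    using uniform_closure_zero [OF G] by (simp add: poly_op_0 [abs_def])
next
  case (pCons a p)
  have "poly_op (pCons a p) T = (\<lambda>x. a *\<^sub>C x + (T \<circ> poly_op p T) x)"
    by (simp add: poly_op_pCons [OF T(1)] fun_eq_iff)
  then show ?case
    using uniform_closure_add [OF G uniform_closure_scale [OF G one, of a]
        uniform_closure_mult [OF G T(2) pCons.IH]] by simp
qed

text \<open>The power method: after removal of the larger eigenvalues, the powers of the normalised
  operator converge in norm to the projection onto the next eigenvector.\<close>

lemma spectral_projections_in_uniform_closure:
  fixes e :: "bool \<times> nat \<Rightarrow> 'a::complex_hilbert" and w :: "nat \<Rightarrow> real"
  assumes G: "G \<subseteq> bounded_ops" and e: "orthonormal_basis UNIV e"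
    and T: "T \<in> uniform_closure (op_algebra G)"
    and Te: "\<And>n. T (e (True, n)) = complex_of_real (w n) *\<^sub>C e (True, n)" "\<And>n. T (e (False, n)) = 0"
    and pos: "\<And>n. w n > 0" and dec: "\<And>m n. m < n \<Longrightarrow> w n < w m"
  shows "rank_one (e (True, n)) (e (True, n)) \<in> uniform_closure (op_algebra G)"
proof (induction n rule: less_induct)
  case (less n)
  define E where "E j = rank_one (e (True, j)) (e (True, j))" for j
  have ee: "cinner (e k) (e l) = (if k = l then 1 else 0)" for k l
    using orthonormal_onD [OF orthonormal_basis_orthonormal [OF e]] by simp
  \<comment> \<open>Deflation: the eigenvalues before \<open>n\<close> are removed by the
    projections already obtained, and the largest remaining one is scaled to 1.\<close>
  define S where "S x = complex_of_real (1 / w n) *\<^sub>C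
    (T x - (\<Sum>j<n. complex_of_real (w j) *\<^sub>C E j x))" for x
  have S: "S \<in> uniform_closure (op_algebra G)"
    unfolding S_def using less.IH
    by (intro uniform_closure_scale [OF G] uniform_closure_diff [OF G] uniform_closure_sum [OF G] T)
      (simp_all add: E_def)
  then have bS: "bounded_clinear S"
    by (simp add: uniform_closure_def bounded_ops_def)
  define \<nu> where "\<nu> k = (if fst k \<and> n \<le> snd k then w (snd k) / w n else 0)" for k :: "bool \<times> nat"
  have Se: "S (e k) = complex_of_real (\<nu> k) *\<^sub>C e k" for k
  proof (cases k)
    case (Pair b j)
    have sum: "(\<Sum>i<n. complex_of_real (w i) *\<^sub>C E i (e (b, j)))
        = (\<Sum>i<n. if i = j then if b then complex_of_real (w j) *\<^sub>C e (True, j) else 0 else 0)"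
      by (intro sum.cong) (auto simp: E_def rank_one_def ee scaleC_simps)
    show ?thesis
      unfolding Pair S_def sum using pos [of n]
      by (cases b) (auto simp: Te \<nu>_def scaleC_simps)
  qed
  have Spow: "(S ^^ m) (e k) = complex_of_real (\<nu> k ^ m) *\<^sub>C e k" for m k
    by (induction m) (simp_all add: Se bounded_clinear_scaleC [OF bS] scaleC_simps mult.commute)
  \<comment> \<open>The second largest eigenvalue of \<open>S\<close>, hence the rate of
    convergence. It is below 1 because \<open>w\<close> decreases strictly.\<close>
  define r where "r = w (Suc n) / w n"
  have r: "0 < r" "r < 1"
    using pos [of n] pos [of "Suc n"] dec [of n "Suc n"] by (simp_all add: r_def)
  have bE: "bounded_clinear (E n)"
    by (simp add: E_def bounded_clinear_rank_one)
  \<comment> \<open>The powers start at 1, since the zeroth power is the identity, whose membership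
    in the closure is not assumed here.\<close>
  have bound: "norm (E n x - (S ^^ Suc m) x) \<le> r ^ Suc m * norm x" for m x
  proof (rule diagonal_norm_le [OF e])
    show "bounded_clinear (\<lambda>x. E n x - (S ^^ Suc m) x)"
      by (intro bounded_clinear_sub bE bounded_clinear_funpow bS)
    show "E n (e k) - (S ^^ Suc m) (e k)
        = ((if k = (True, n) then 1 else 0) - complex_of_real (\<nu> k ^ Suc m)) *\<^sub>C e k" for k
      unfolding Spow by (auto simp: E_def rank_one_def ee scaleC_simps cvec.scale_left_diff_distrib)
    show "norm ((if k = (True, n) then 1 else 0) - complex_of_real (\<nu> k ^ Suc m)) \<le> r ^ Suc m" for k
    proof (cases "fst k \<and> n < snd k")
      case True
      then have "w (snd k) \<le> w (Suc n)"
        using dec [of "Suc n" "snd k"] by (cases "snd k = Suc n") auto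
      then have "0 \<le> \<nu> k" "\<nu> k \<le> r"
        using True pos [of n] pos [of "snd k"] by (auto simp: \<nu>_def r_def divide_right_mono)
      then have "\<nu> k ^ Suc m \<le> r ^ Suc m" "0 \<le> \<nu> k ^ Suc m"
        by (auto intro: power_mono simp del: power_Suc)
      moreover have "k \<noteq> (True, n)"
        using True by auto
      ultimately show ?thesis
        by (simp del: power_Suc of_real_power)
    next
      case False
      then have "\<nu> k = (if k = (True, n) then 1 else 0)"
        using pos [of n] by (cases k) (auto simp: \<nu>_def)
      then show ?thesis
        using r by auto
    qed
  qed (use r in simp)
  have "E n \<in> uniform_closure (op_algebra G)"
  proof (rule uniform_closure_limit [OF G])
    fix \<epsilon> :: real assume "\<epsilon> > 0"
    then obtain m where "r ^ m < \<epsilon>"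
      using real_arch_pow_inv r by blast
    moreover have "r ^ Suc m \<le> r ^ m"
      using r by (intro power_decreasing) auto
    ultimately have "norm (E n x - (S ^^ Suc m) x) \<le> \<epsilon> * norm x" for x
      using bound [of x m] mult_right_mono [of "r ^ Suc m" \<epsilon> "norm x"] by (simp del: power_Suc)
    then show "\<exists>S\<in>uniform_closure (op_algebra G). \<forall>x. norm (E n x - S x) \<le> \<epsilon> * norm x"
      using uniform_closure_funpow [OF G S] by blast
  qed (use bE in \<open>simp add: bounded_ops_def\<close>)
  then show ?case
    by (simp add: E_def)
qed


lemma coupled_bases_generate:
  fixes e :: "bool \<times> nat \<Rightarrow> 'a::complex_hilbert" and c :: "nat \<times> nat \<Rightarrow> 'a" and J :: "nat set"
    and s t :: "nat \<Rightarrow> real" and \<mu> :: "nat \<Rightarrow> complex"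
  defines "I \<equiv> Sigma {..<3} (\<lambda>k. if k = 2 then J else UNIV)"
    and "f \<equiv> \<lambda>(k, n). if k
      then complex_of_real (t n) *\<^sub>C e (True, n) - complex_of_real (s n) *\<^sub>C e (False, n)
      else complex_of_real (s n) *\<^sub>C e (True, n) + complex_of_real (t n) *\<^sub>C e (False, n)"
  assumes e: "orthonormal_basis UNIV e" and c: "orthonormal_basis I c" and J: "0 \<in> J"
    and c0: "\<And>n. c (0, n) = e (False, n)"
    and c20: "\<And>n. cinner (c (2, 0)) (e (True, n)) \<noteq> 0"
    and c2: "\<And>n. Suc n \<in> J \<Longrightarrow> cinner (e (True, 0)) (c (2, Suc n)) = 0"
    and st: "\<And>n. (s n)\<^sup>2 + (t n)\<^sup>2 = 1" "\<And>n. s n > 0" "\<And>n. t n > 0" "\<And>m n. m < n \<Longrightarrow> s n < s m"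
    and U: "bounded_clinear U" "\<And>k. U (f k) = (if fst k then \<beta> else \<alpha>) *\<^sub>C f k"
    and V: "bounded_clinear V" "\<And>k. k \<in> I \<Longrightarrow> V (c k) = \<mu> (fst k) *\<^sub>C c k"
    and \<alpha>\<beta>: "\<alpha> \<noteq> \<beta>" "\<alpha> \<noteq> 0" "\<beta> \<noteq> 0" and \<mu>: "inj_on \<mu> {..<3}"
  shows "weak_op_topology closure_of (op_algebra {U, V}) = bounded_ops"
proof -
  have G: "{U, V} \<subseteq> bounded_ops"
    using U V by (simp add: bounded_ops_def)
  define R where "R = uniform_closure (op_algebra {U, V})"
  note R_diff = uniform_closure_diff [OF G, folded R_def]
    and R_scale = uniform_closure_scale [OF G, folded R_def]
    and R_mult = uniform_closure_mult [OF G, folded R_def]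
  have UR: "U \<in> R" and VR: "V \<in> R"
    unfolding R_def using uniform_closure_superset [OF op_algebra_bounded [OF G]] op_algebra.gen by blast+
  define g h where "g n = e (False, n)" and "h n = e (True, n)" for n
  have ee: "cinner (e k) (e l) = (if k = l then 1 else 0)" for k l
    using orthonormal_onD [OF orthonormal_basis_orthonormal [OF e]] by simp
  have cc: "cinner (c k) (c l) = (if k = l then 1 else 0)" if "k \<in> I" "l \<in> I" for k l
    using orthonormal_onD [OF orthonormal_basis_orthonormal [OF c]] that by simp
  have f: "orthonormal_basis UNIV f"
    unfolding f_def using rotated_basis [OF e st(1)] .
  have one: "(\<lambda>x. x) \<in> R"
  proof -
    \<comment> \<open>\<open>U\<close> satisfies the quadratic equation with roots
      \<open>\<alpha>\<close> and \<open>\<beta>\<close>. Solving it for the constant term expresses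
      the identity by \<open>U\<close> and its square.\<close>
    define D where "D x = (1 / (\<alpha> * \<beta>)) *\<^sub>C ((\<alpha> + \<beta>) *\<^sub>C U x - (U \<circ> U) x)" for x
    have D: "D \<in> R"
      unfolding D_def by (intro R_scale R_diff R_mult UR)
    then have bD: "bounded_clinear D"
      by (simp add: R_def uniform_closure_def bounded_ops_def)
    have "D (f k) = 1 *\<^sub>C f k" for k
      using \<alpha>\<beta> by (simp add: D_def U bounded_clinear_scaleC [OF U(1)] scaleC_simps field_simps
          flip: cvec.scale_left_diff_distrib)
    then have "D x = x" for x
      using diagonal_coeff [OF f bD, of "\<lambda>k. 1"] by (intro orthonormal_basis_eqI [OF f]) simp
    then show ?thesis
      using D by (metis ext)
  qed
  note R_poly = uniform_closure_poly_op [OF G _ _ one [unfolded R_def], folded R_def]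
  have "inj (\<lambda>k. if k then \<beta> else \<alpha>)"
    using \<alpha>\<beta>(1) by (auto simp: inj_on_def)
  then obtain p where p: "\<And>k. poly p (if k then \<beta> else \<alpha>) = (if k = False then 1 else 0)"
    by (rule lagrange_polynomial [OF finite _ UNIV_I, where m = False]) blast
  \<comment> \<open>The spectral projection of \<open>U\<close> for \<open>\<alpha>\<close>, a
    polynomial in \<open>U\<close> and hence in \<open>R\<close>.\<close>
  define P where "P = poly_op p U"
  have PR: "P \<in> R" and bP: "bounded_clinear P"
    unfolding P_def using U(1) UR by (auto intro: R_poly bounded_clinear_poly_op)
  have Pf: "P (f k) = (if fst k then 0 else 1) *\<^sub>C f k" for k
    using poly_op_eigenvector [OF U(1) U(2), of p k] p [of "fst k"] by (simp add: P_def)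
  have P_sym: "cinner (P x) y = cinner x (P y)" for x y
    by (rule diagonal_symmetric [OF f bP Pf]) simp
  define \<sigma> \<tau> where "\<sigma> n = complex_of_real (s n)" and "\<tau> n = complex_of_real (t n)" for n
  have \<sigma>\<tau>: "\<sigma> n * \<sigma> n + \<tau> n * \<tau> n = 1" "\<sigma> n \<noteq> 0" "\<tau> n \<noteq> 0" for n
    using arg_cong [OF st(1) [of n], of complex_of_real] st(2,3) [of n]
    by (simp_all add: \<sigma>_def \<tau>_def power2_eq_square)
  have Ph: "P (h n) = (\<sigma> n * \<sigma> n) *\<^sub>C h n + (\<sigma> n * \<tau> n) *\<^sub>C g n" for n
  proof -
    have "h n = \<sigma> n *\<^sub>C f (False, n) + \<tau> n *\<^sub>C f (True, n)"
    proof (rule orthonormal_basis_eqI [OF e])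
      fix k
      show "cinner (h n) (e k) = cinner (\<sigma> n *\<^sub>C f (False, n) + \<tau> n *\<^sub>C f (True, n)) (e k)"
        using \<sigma>\<tau>(1)
        by (cases k; cases "fst k") (simp_all add: h_def f_def cinner_simps ee \<sigma>_def \<tau>_def)
    qed
    then have "P (h n) = \<sigma> n *\<^sub>C f (False, n)"
      by (simp add: bounded_clinear_simps [OF bP] Pf scaleC_simps)
    then show ?thesis
      by (simp add: f_def h_def g_def \<sigma>_def \<tau>_def scaleC_add_right scaleC_scaleC)
  qed
  have "\<exists>Q\<in>R. \<forall>k\<in>I. Q (c k) = (if fst k = m then 1 else 0) *\<^sub>C c k" if m: "m < 3" for m
  proof -
    obtain q where q: "\<And>k. k < 3 \<Longrightarrow> poly q (\<mu> k) = (if k = m then 1 else 0)"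
      using lagrange_polynomial [of "{..<3}" \<mu> m] \<mu> m by auto
    have "poly_op q V (c k) = (if fst k = m then 1 else 0) *\<^sub>C c k" if "k \<in> I" for k
      using poly_op_eigenvector [OF V(1) V(2) [OF that], of q] q [of "fst k"] that
      by (auto simp: I_def)
    then show ?thesis
      using R_poly [OF V(1) VR] by blast
  qed
  from this [of 0] this [of 2] obtain Q0 Q2 where Q0R: "Q0 \<in> R" and Q2R: "Q2 \<in> R"
    and Q0c: "\<And>k. k \<in> I \<Longrightarrow> Q0 (c k) = (if fst k = 0 then 1 else 0) *\<^sub>C c k"
    and Q2c: "\<And>k. k \<in> I \<Longrightarrow> Q2 (c k) = (if fst k = 2 then 1 else 0) *\<^sub>C c k"
    by auto
  have bQ0: "bounded_clinear Q0" and bQ2: "bounded_clinear Q2"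
    using Q0R Q2R by (auto simp: R_def uniform_closure_def bounded_ops_def)
  have Q0_sym: "cinner (Q0 x) y = cinner x (Q0 y)" and Q2_sym: "cinner (Q2 x) y = cinner x (Q2 y)" for x y
    by (rule diagonal_symmetric [OF c bQ0 Q0c]; simp) (rule diagonal_symmetric [OF c bQ2 Q2c]; simp)
  have Q0g: "Q0 (g n) = g n" for n
    using Q0c [of "(0, n)"] by (simp add: I_def c0 g_def scaleC_one)
  have Q0h: "Q0 (h n) = 0" for n
  proof (rule orthonormal_basis_eqI [OF c])
    fix k assume k: "k \<in> I"
    show "cinner (Q0 (h n)) (c k) = cinner 0 (c k)"
      using diagonal_coeff [OF c bQ0 Q0c k, of "h n"]
      by (cases k) (auto simp: c0 h_def ee split: if_splits)
  qed
  define v \<gamma> where "v = c (2, 0)" and "\<gamma> = cinner (h 0) v"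
  have v: "cinner v (h n) \<noteq> 0" for n
    using c20 by (simp add: v_def h_def)
  have "\<gamma> \<noteq> 0"
    using v [of 0] cinner_eq_0_commute by (auto simp: \<gamma>_def)
  \<comment> \<open>Among the basis vectors of the third block only \<open>v\<close> has a nonzero
    inner product with \<open>h 0\<close>.\<close>
  have Q2h: "Q2 (h 0) = \<gamma> *\<^sub>C v"
  proof (rule orthonormal_basis_eqI [OF c])
    fix k assume k: "k \<in> I"
    obtain i n where kn: "k = (i, n)"
      by (meson surj_pair)
    have "(2, 0) \<in> I"
      using J by (simp add: I_def)
    then show "cinner (Q2 (h 0)) (c k) = cinner (\<gamma> *\<^sub>C v) (c k)"
      using diagonal_coeff [OF c bQ2 Q2c k, of "h 0"] k c2
      by (cases n) (auto simp: kn cinner_simps v_def cc \<gamma>_def h_def I_def)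
  qed
  have T: "(\<lambda>x. x - Q0 x) \<circ> (P \<circ> (\<lambda>x. x - Q0 x)) \<in> R"
    by (intro R_mult R_diff one PR Q0R)
  have E: "rank_one (h n) (h n) \<in> R" for n
    unfolding R_def h_def
  proof (rule spectral_projections_in_uniform_closure [OF G e T [unfolded R_def]])
    show "((\<lambda>x. x - Q0 x) \<circ> (P \<circ> (\<lambda>x. x - Q0 x))) (e (True, n))
        = complex_of_real ((s n)\<^sup>2) *\<^sub>C e (True, n)" for n
      unfolding h_def [symmetric]
      by (simp add: Q0h Ph bounded_clinear_simps [OF bQ0] Q0g scaleC_simps)
        (simp add: \<sigma>_def power2_eq_square)
    show "((\<lambda>x. x - Q0 x) \<circ> (P \<circ> (\<lambda>x. x - Q0 x))) (e (False, n)) = 0" for n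
      unfolding g_def [symmetric]
      by (simp add: Q0g bounded_clinear_zero [OF bP] bounded_clinear_zero [OF bQ0])
    show "(s n)\<^sup>2 > 0" for n
      using st(2) [of n] by simp
    show "(s n)\<^sup>2 < (s m)\<^sup>2" if "m < n" for m n
      using st(4) [OF that] st(2) [of n] by (intro power_strict_mono) auto
  qed
  have hh: "rank_one (h j) (h 0) \<in> R" "rank_one (h 0) (h j) \<in> R" for j
  proof -
    \<comment> \<open>The matrix entry of \<open>Q2\<close> from \<open>h 0\<close> to
      \<open>h j\<close>, by which the compression is divided. Symmetry of \<open>Q2\<close> makes
      the opposite entry \<open>cnj k\<close>.\<close>
    define k where "k = \<gamma> * cinner v (h j)"
    have k: "k \<noteq> 0"
      using \<open>\<gamma> \<noteq> 0\<close> v by (simp add: k_def)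
    have "(\<lambda>x. (1 / k) *\<^sub>C (rank_one (h j) (h j) \<circ> (Q2 \<circ> rank_one (h 0) (h 0))) x) \<in> R"
      by (intro R_scale R_mult Q2R E)
    also have "(\<lambda>x. (1 / k) *\<^sub>C (rank_one (h j) (h j) \<circ> (Q2 \<circ> rank_one (h 0) (h 0))) x)
        = rank_one (h j) (h 0)"
      using k by (simp add: fun_eq_iff rank_one_def bounded_clinear_scaleC [OF bQ2] Q2h cinner_simps
          scaleC_simps k_def)
    finally show "rank_one (h j) (h 0) \<in> R" .
    have "cinner (Q2 (h j)) (h 0) = cnj k"
      unfolding Q2_sym Q2h by (simp add: cinner_simps k_def flip: cinner_commute)
    then have "(\<lambda>x. (1 / cnj k) *\<^sub>C (rank_one (h 0) (h 0) \<circ> (Q2 \<circ> rank_one (h j) (h j))) x)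
        = rank_one (h 0) (h j)"
      using k by (simp add: fun_eq_iff rank_one_def bounded_clinear_scaleC [OF bQ2] cinner_simps
          scaleC_simps)
    moreover have "(\<lambda>x. (1 / cnj k) *\<^sub>C (rank_one (h 0) (h 0) \<circ> (Q2 \<circ> rank_one (h j) (h j))) x) \<in> R"
      by (intro R_scale R_mult Q2R E)
    ultimately show "rank_one (h 0) (h j) \<in> R"
      by simp
  qed
  have Q0Ph: "Q0 (P (h j)) = (\<sigma> j * \<tau> j) *\<^sub>C g j" for j
    by (simp add: Ph bounded_clinear_simps [OF bQ0] Q0h Q0g scaleC_simps)
  have gh: "rank_one (g j) (h 0) \<in> R" "rank_one (h 0) (g j) \<in> R" for j
  proof -
    define k where "k = \<sigma> j * \<tau> j"
    have k: "k \<noteq> 0"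
      using \<sigma>\<tau> by (simp add: k_def)
    have "(\<lambda>x. (1 / k) *\<^sub>C (Q0 \<circ> (P \<circ> rank_one (h j) (h 0))) x) = rank_one (g j) (h 0)"
      using k by (simp add: fun_eq_iff rank_one_def bounded_clinear_scaleC [OF bP]
          bounded_clinear_scaleC [OF bQ0] Q0Ph scaleC_simps k_def)
    moreover have "(\<lambda>x. (1 / k) *\<^sub>C (Q0 \<circ> (P \<circ> rank_one (h j) (h 0))) x) \<in> R"
      by (intro R_scale R_mult PR Q0R hh)
    ultimately show "rank_one (g j) (h 0) \<in> R"
      by simp
    \<comment> \<open>For the opposite direction the product \<open>Q0 P\<close> is replaced by its
      adjoint \<open>P Q0\<close>.\<close>
    have "cinner (P (Q0 x)) (h j) = cnj k * cinner x (g j)" for x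
      unfolding P_sym Q0_sym Q0Ph by (simp add: cinner_simps k_def)
    then have "(\<lambda>x. (1 / cnj k) *\<^sub>C (rank_one (h 0) (h j) \<circ> (P \<circ> Q0)) x) = rank_one (h 0) (g j)"
      using k by (simp add: fun_eq_iff rank_one_def scaleC_simps)
    moreover have "(\<lambda>x. (1 / cnj k) *\<^sub>C (rank_one (h 0) (h j) \<circ> (P \<circ> Q0)) x) \<in> R"
      by (intro R_scale R_mult PR Q0R hh)
    ultimately show "rank_one (h 0) (g j) \<in> R"
      by simp
  qed
  have eh: "rank_one (e k) (h 0) \<in> R" "rank_one (h 0) (e k) \<in> R" for k
    using hh [of "snd k"] gh [of "snd k"] unfolding g_def h_def
    by (metis (full_types) prod.collapse)+
  show ?thesis
  proof (rule weak_op_dense_if_matrix_units [OF G e])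
    fix k l
    have "rank_one (e k) (h 0) \<circ> rank_one (h 0) (e l) = rank_one (e k) (e l)"
      by (simp add: fun_eq_iff rank_one_def cinner_simps ee h_def)
    then show "rank_one (e k) (e l) \<in> uniform_closure (op_algebra {U, V})"
      using R_mult [OF eh(1) eh(2), of k l] by (simp add: R_def)
  qed
qed

section \<open>Sufficiency, and the equivalence\<close>

lemma dense_orbit_representatives:
  fixes U V :: "'a::complex_hilbert \<Rightarrow> 'a"
  assumes sep: "separable_space (euclidean :: 'a topology)"
    and U: "unitary_op U" "is_minimal_poly p U" "degree p = 2"
    and V: "unitary_op V" "is_minimal_poly q V" "degree q = 3"
    and infU: "\<And>a. op_eigenvalue U a \<Longrightarrow> infinite_cdim (op_eigenspace U a)"
    and l: "l \<noteq> m" "op_eigenvalue V l" "op_eigenvalue V m"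
      "infinite_cdim (op_eigenspace V l)" "infinite_cdim (op_eigenspace V m)"
  shows "\<exists>U0\<in>unitary_orbit U. \<exists>V0\<in>unitary_orbit V.
    weak_op_topology closure_of (op_algebra {U0, V0}) = bounded_ops"
proof -
  have bU: "bounded_clinear U" and bV: "bounded_clinear V"
    using U V by (auto simp: unitary_op_def)
  obtain A where A: "finite A" "card A = 2" "p = (\<Prod>a\<in>A. [:- a, 1:])"
    "\<And>a. op_eigenvalue U a \<longleftrightarrow> a \<in> A"
    using unitary_minimal_poly_splits [OF U(1,2)] U(3) by metis
  obtain B where B: "finite B" "card B = 3" "q = (\<Prod>a\<in>B. [:- a, 1:])"
    "\<And>a. op_eigenvalue V a \<longleftrightarrow> a \<in> B"
    using unitary_minimal_poly_splits [OF V(1,2)] V(3) by metis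
  obtain \<alpha> \<beta> where \<alpha>\<beta>: "A = {\<alpha>, \<beta>}" "\<alpha> \<noteq> \<beta>"
    using A(2) by (auto simp: card_2_iff)
  \<comment> \<open>Nonzero eigenvalues allow the identity to be recovered from
    \<open>U0\<close>.\<close>
  have nz: "a \<noteq> 0" if a: "op_eigenvalue U a" for a
  proof -
    obtain x where "x \<noteq> 0" "U x = a *\<^sub>C x"
      using a by (auto simp: op_eigenvalue_def)
    then show ?thesis
      using unitary_norm [OF U(1), of x] by auto
  qed
  have "\<exists>b :: nat \<Rightarrow> 'a. orthonormal_basis_of (op_eigenspace U a) UNIV b" if "a \<in> A" for a
    using infinite_orthonormal_basis [OF sep subspace_op_eigenspace [OF bU] infU] A(4) that by metis
  then obtain b where b: "\<And>a. a \<in> A \<Longrightarrow> orthonormal_basis_of (op_eigenspace U a) (UNIV :: nat set) (b a)"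
    by metis
  \<comment> \<open>The reference basis is an eigenbasis of \<open>U\<close> itself;
    \<open>U0\<close> will be diagonal in its rotation and \<open>V0\<close> in the coupled basis
    \<open>c\<close>.\<close>
  define e where "e = (\<lambda>(k, n). b (if k then \<beta> else \<alpha>) n)"
  have "orthonormal_basis (Sigma A (\<lambda>_. UNIV)) (\<lambda>(a, n). b a n)"
    using U(2) by (intro unitary_eigenbasis [OF U(1) A(1)] b) (simp_all add: is_minimal_poly_def A(3))
  moreover have "bij_betw (\<lambda>(k, n :: nat). (if k then \<beta> else \<alpha>, n)) UNIV (Sigma A (\<lambda>_. UNIV))"
    using \<alpha>\<beta> by (intro bij_betwI') (auto split: if_splits)
  ultimately have "orthonormal_basis UNIV (\<lambda>i. (\<lambda>(a, n). b a n) ((\<lambda>(k, n :: nat). (if k then \<beta> else \<alpha>, n)) i))"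
    by (rule orthonormal_basis_reindex)
  then have e: "orthonormal_basis UNIV e"
    by (simp add: e_def case_prod_unfold)
  have Ue: "U (e k) = (if fst k then \<beta> else \<alpha>) *\<^sub>C e k" for k
    using b [of \<alpha>] b [of \<beta>] \<alpha>\<beta>(1)
    by (cases k) (auto simp: e_def orthonormal_basis_of_def op_eigenspace_def image_subset_iff)
  have lm: "l \<in> B" "m \<in> B"
    using l B by auto
  then have "card (B - {l, m}) = 1"
    using l(1) B by (simp add: card_Diff_subset)
  then obtain r where r: "B - {l, m} = {r}"
    by (rule card_1_singletonE)
  then have Blmr: "B = {l, m, r}" "r \<noteq> l" "r \<noteq> m"
    using lm by auto
  obtain x where x: "x \<in> op_eigenspace V r" "x \<noteq> 0"
    using B(4) [of r] Blmr by (auto simp: op_eigenvalue_def op_eigenspace_def)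
  obtain J :: "nat set" and br :: "nat \<Rightarrow> 'a" where J: "0 \<in> J" "orthonormal_basis_of (op_eigenspace V r) J br"
    by (rule nontrivial_orthonormal_basis [OF sep subspace_op_eigenspace [OF bV] x]) blast
  obtain bl :: "nat \<Rightarrow> 'a" where bl: "orthonormal_basis_of (op_eigenspace V l) UNIV bl"
    by (rule infinite_orthonormal_basis [OF sep subspace_op_eigenspace [OF bV] l(4)]) blast
  obtain bm :: "nat \<Rightarrow> 'a" where bm: "orthonormal_basis_of (op_eigenspace V m) UNIV bm"
    by (rule infinite_orthonormal_basis [OF sep subspace_op_eigenspace [OF bV] l(5)]) blast
  define K where "K a = (if a = r then J else UNIV)" for a
  define bV where "bV a = (if a = l then bl else if a = m then bm else br)" for a
  have basis: "orthonormal_basis_of (op_eigenspace V a) (K a) (bV a)" if "a \<in> B" for a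
    using that Blmr l(1) bl bm J by (auto simp: K_def bV_def)
  \<comment> \<open>The two infinite-dimensional eigenspaces occupy blocks 0 and 1; the eigenvalue
    of unknown multiplicity takes block 2, indexed by \<open>J\<close>.\<close>
  define \<mu> where "\<mu> k = (if k = 0 then l else if k = 1 then m else r)" for k :: nat
  define I where "I = Sigma {..<3} (\<lambda>k. if k = (2::nat) then J else UNIV)"
  have three: "k < 3 \<longleftrightarrow> k = 0 \<or> k = 1 \<or> k = 2" for k :: nat
    by auto
  have \<mu>: "inj_on \<mu> {..<3}"
    using Blmr l(1) by (auto simp: inj_on_def \<mu>_def three)
  have \<mu>B: "\<mu> k \<in> B" for k
    by (simp add: \<mu>_def Blmr)
  have K\<mu>: "K (\<mu> k) = (if k = 2 then J else UNIV)" if "k < 3" for k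
    using that Blmr by (auto simp: K_def \<mu>_def three)
  have "orthonormal_basis (Sigma B K) (\<lambda>(a, n). bV a n)"
    using V(2) by (intro unitary_eigenbasis [OF V(1) B(1)] basis) (simp_all add: is_minimal_poly_def B(3))
  moreover have "bij_betw (\<lambda>(k, n). (\<mu> k, n)) I (Sigma B K)"
    unfolding bij_betw_def
  proof
    show "inj_on (\<lambda>(k, n). (\<mu> k, n)) I"
      using \<mu> by (auto simp: inj_on_def I_def)
    show "(\<lambda>(k, n). (\<mu> k, n)) ` I = Sigma B K"
    proof
      show "(\<lambda>(k, n). (\<mu> k, n)) ` I \<subseteq> Sigma B K"
        using \<mu>B by (auto simp: I_def K\<mu>)
      show "Sigma B K \<subseteq> (\<lambda>(k, n). (\<mu> k, n)) ` I"
      proof clarify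
        fix a n assume *: "a \<in> B" "n \<in> K a"
        have "a = \<mu> 0 \<or> a = \<mu> 1 \<or> a = \<mu> 2"
          using *(1) Blmr(1) by (auto simp: \<mu>_def)
        then obtain k where k: "k < 3" "a = \<mu> k"
          using three by blast
        then have "(k, n) \<in> I"
          using * K\<mu> by (simp add: I_def)
        then show "(a, n) \<in> (\<lambda>(k, n). (\<mu> k, n)) ` I"
          by (rule rev_image_eqI) (simp add: k)
      qed
    qed
  qed
  ultimately have "orthonormal_basis I (\<lambda>i. (\<lambda>(a, n). bV a n) ((\<lambda>(k, n). (\<mu> k, n)) i))"
    by (rule orthonormal_basis_reindex)
  then have d: "orthonormal_basis I (\<lambda>(k, n). bV (\<mu> k) n)"
    by (simp add: case_prod_unfold)
  have Vd: "V ((\<lambda>(k, n). bV (\<mu> k) n) k) = \<mu> (fst k) *\<^sub>C (\<lambda>(k, n). bV (\<mu> k) n) k" if "k \<in> I" for k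
    using basis [OF \<mu>B, of "fst k"] K\<mu> [of "fst k"] that
    unfolding I_def orthonormal_basis_of_def op_eigenspace_def
    by (cases k) (simp add: image_subset_iff)
  obtain c where c: "orthonormal_basis I c" "\<And>n. c (0, n) = e (False, n)"
    "\<And>n. cinner (c (2, 0)) (e (True, n)) \<noteq> 0"
    "\<And>n. Suc n \<in> J \<Longrightarrow> cinner (e (True, 0)) (c (2, Suc n)) = 0"
    unfolding I_def by (rule coupling_basis [OF sep e J(1)]) blast
  \<comment> \<open>The shift by 2 keeps \<open>s n\<close> below 1 already at \<open>n = 0\<close>,
    so that \<open>t n\<close> is positive throughout.\<close>
  define s t where "s n = sqrt (1 / (real n + 2))" and "t n = sqrt (1 - 1 / (real n + 2))" for n
  have st: "(s n)\<^sup>2 + (t n)\<^sup>2 = 1" "s n > 0" "t n > 0" for n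
    by (simp_all add: s_def t_def field_simps)
  have s_dec: "s n < s m" if "m < n" for m n
    using that by (simp add: s_def frac_less2)
  note f = rotated_basis [of e s t, OF e st(1)]
  obtain U0 where U0: "U0 \<in> unitary_orbit U" "bounded_clinear U0"
    and U0f: "\<And>k. U0 ((\<lambda>(k, n). if k
      then complex_of_real (t n) *\<^sub>C e (True, n) - complex_of_real (s n) *\<^sub>C e (False, n)
      else complex_of_real (s n) *\<^sub>C e (True, n) + complex_of_real (t n) *\<^sub>C e (False, n)) k)
      = (if fst k then \<beta> else \<alpha>) *\<^sub>C (\<lambda>(k, n). if k
      then complex_of_real (t n) *\<^sub>C e (True, n) - complex_of_real (s n) *\<^sub>C e (False, n)
      else complex_of_real (s n) *\<^sub>C e (True, n) + complex_of_real (t n) *\<^sub>C e (False, n)) k"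
    by (rule unitary_orbit_diagonal [OF U(1) f e Ue]) (simp_all only: UNIV_I)
  obtain V0 where V0: "V0 \<in> unitary_orbit V" "bounded_clinear V0"
    and V0c: "\<And>k. k \<in> I \<Longrightarrow> V0 (c k) = \<mu> (fst k) *\<^sub>C c k"
    by (rule unitary_orbit_diagonal [OF V(1) c(1) d Vd]) blast+
  have "weak_op_topology closure_of (op_algebra {U0, V0}) = bounded_ops"
    using coupled_bases_generate [OF e c(1) [unfolded I_def] J(1) c(2-4) st s_dec U0(2) U0f V0(2)
        V0c [unfolded I_def] \<alpha>\<beta>(2) nz nz \<mu>] A(4) \<alpha>\<beta>(1) by blast
  then show ?thesis
    using U0(1) V0(1) by blast
qed

theorem theorem4p2:
  fixes U V :: "'a::complex_hilbert \<Rightarrow> 'a"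
    and p q :: "complex poly"
  assumes "infinite_cdim (UNIV :: 'a set)"
    and "separable_space (euclidean :: 'a topology)"
    and "unitary_op U" and "unitary_op V"
    and "is_minimal_poly p U" and "degree p = 2"
    and "is_minimal_poly q V" and "degree q = 3"
  shows "(\<exists>U0 \<in> unitary_orbit U. \<exists>V0 \<in> unitary_orbit V.
            weak_op_topology closure_of (op_algebra {U0, V0}) = bounded_ops)
         \<longleftrightarrow>
         (\<forall>l. op_eigenvalue U l \<longrightarrow> infinite_cdim (op_eigenspace U l)) \<and>
         (\<exists>l m. l \<noteq> m \<and> op_eigenvalue V l \<and> op_eigenvalue V m \<and>
            infinite_cdim (op_eigenspace V l) \<and> infinite_cdim (op_eigenspace V m))"
    (is "?dense \<longleftrightarrow> ?infU \<and> ?infV")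
proof
  assume "?infU \<and> ?infV"
  then show ?dense
    using dense_orbit_representatives [OF assms(2,3,5,6,4,7,8)] by blast
next
  assume ?dense
  then obtain U0 V0 where 0: "U0 \<in> unitary_orbit U" "V0 \<in> unitary_orbit V"
    and dense: "weak_op_topology closure_of (op_algebra {U0, V0}) = bounded_ops" by blast
  obtain A where A: "finite A" "card A = 2" "p = (\<Prod>a\<in>A. [:- a, 1:])"
    "\<And>a. op_eigenvalue U a \<longleftrightarrow> a \<in> A"
    using unitary_minimal_poly_splits [OF assms(3,5)] assms(6) by metis
  obtain B where B: "finite B" "card B = 3" "q = (\<Prod>a\<in>B. [:- a, 1:])"
    "\<And>a. op_eigenvalue V a \<longleftrightarrow> a \<in> B"
    using unitary_minimal_poly_splits [OF assms(4,7)] assms(8) by metis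
  have pU: "poly_op (\<Prod>a\<in>A. [:- a, 1:]) U = (\<lambda>x. 0)" and qV: "poly_op (\<Prod>a\<in>B. [:- a, 1:]) V = (\<lambda>x. 0)"
    using assms(5,7) by (simp_all add: is_minimal_poly_def A(3) B(3))
  have ?infU
  proof (rule ccontr)
    assume "\<not> ?infU"
    then obtain b where b: "b \<in> A" "\<not> infinite_cdim (op_eigenspace U b)"
      using A(4) by blast
    have "card (A - {b}) = 1"
      using A b by simp
    then obtain a where "A - {b} = {a}"
      by (rule card_1_singletonE)
    then have "a \<in> A" "A - {a} = {b}"
      using b(1) by auto
    then show False
      using not_dense_if_one_infinite_eigenspace [OF assms(1,4,3,7) _ pU A(1), of a b V0 U0]
        b A(4) 0 dense assms(8) by simp
  qed
  moreover have ?infV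
  proof (rule ccontr)
    assume "\<not> ?infV"
    then have two: "a = b" if "a \<in> B" "b \<in> B" "infinite_cdim (op_eigenspace V a)"
        "infinite_cdim (op_eigenspace V b)" for a b
      using that B(4) by blast
    have "B \<noteq> {}"
      using B(2) by auto
    \<comment> \<open>\<open>a\<close> is the eigenvalue with infinite-dimensional eigenspace if
      there is one, and arbitrary otherwise.\<close>
    then obtain a where a: "a \<in> B" "\<And>b. b \<in> B - {a} \<Longrightarrow> \<not> infinite_cdim (op_eigenspace V b)"
      using two by (metis Diff_iff all_not_in_conv insertI1)
    have "card (B - {a}) = 2"
      using B a(1) by simp
    then obtain b where b: "b \<in> B - {a}"
      by (metis card.empty equals0I zero_neq_numeral)
    then have "weak_op_topology closure_of (op_algebra {V0, U0}) \<noteq> bounded_ops"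
      using not_dense_if_one_infinite_eigenspace [OF assms(1,3,4,5) _ qV B(1) a b _ 0] B(4) assms(6)
      by simp
    then show False
      using dense by (simp add: insert_commute)
  qed
  ultimately show "?infU \<and> ?infV" ..
qed

end
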